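(* Let $B=(\beta_{p-1},\ldots,\beta_0)$ be a Parry alternate base. The substitution $\varphi_B\circ\varphi_{S(B)}\circ\cdots\circ\varphi_{S^{p-1}(B)}$ is primitive and \[ \big(\varphi_B\circ\varphi_{S(B)}\circ\cdots\circ\varphi_{S^{p-1}(B)}\big)(v_B)=v_B. \]
   Context: $\mathbb N=\{0,1,2,\dots\}$. An alternate base of period $p\ge1$ is a bi-infinite periodic sequence $B=(\beta_n)_{n\in\mathbb Z}$ of real numbers greater than $1$ with $\beta_{n+p}=\beta_n$ for all $n$; it is denoted $B=(\beta_{p-1},\ldots,\beta_0)$. For $N\in\mathbb Z$, $S^N(B)=(\beta_{n+N})_{n\in\mathbb Z}$, $S=S^1$. $B$-expansion $d_B(x)=(a_n)_{n\in\mathbb Z}$, written $\cdots a_1a_0\bullet a_{-1}a_{-2}\cdots$, of a real $x\ge0$. If $x\in[0,1)$: $a_n=0$ for $n\ge 0$, $r_{-1}=x$, and for $n\le -1$ iteratively $a_n=\lfloor\beta_n r_n\rfloor$, $r_{n-1}=\beta_n r_n-a_n$. If $x\ge 1$: let $N\ge0$ be minimal with $x<\beta_N\cdots\beta_0$, put $a_n=0$ for $n>N$, $r_N=x/(\beta_N\cdots\beta_0)$, and for $n\le N$ iteratively $a_n=\lfloor\beta_n r_n\rfloor$, $r_{n-1}=\beta_n r_n-a_n$. A $B$-integer is a real $x\ge0$ whose $B$-expansion has only zeros after the radix point ($a_n=0$ for all $n<0$). The set of $B$-integers is unbounded without accumulation points; $(x_k)_{k\in\mathbb N}$ is its increasing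 enumeration. The sequence $w_B=(w_k)_{k\in\mathbb N}$ over $\mathbb N$ is defined by: $w_k$ is the greatest $n\in\mathbb N$ such that $d_B(x_k)$ and $d_B(x_{k+1})$ differ at index $n$. Quasi-greedy expansion of $1$: the limit $\lim_{x\to1^-}d_B(x)$ (in the product topology) exists and has the form $0\bullet a_{-1}a_{-2}\cdots$; one sets $d_B^*(1)=a_{-1}a_{-2}\cdots$. For $n\in\mathbb N$ write $d^*_{S^n(B)}(1)=d_{n,1}d_{n,2}\cdots$ (so $d_{n+p,j}=d_{n,j}$). $B$ is Parry if $d^*_{S^i(B)}(1)$ is eventually periodic for every $i\in\{0,\ldots,p-1\}$. For a Parry alternate base $B$, fix integers $\ell\ge0$, $m\ge1$ such that $d^*_{S^i(B)}(1)$ has preperiod $\ell p$ and period $mp$ for every $i\in\{0,\dots,p-1\}$, i.e. $d_{i,j+mp}=d_{i,j}$ for all $j>\ell p$. Let $\mathcal A=\{0,\ldots,\ell p+mp-1\}$. The infinite word $v_B=(v_k)_{k\in\mathbb N}$ over $\mathcal A$ is given by $v_k=w_k$ if $0\le w_k<\ell p$, and $v_k=\ell p+((w_k-\ell p)\bmod mp)$ otherwise. For $i\in\{0,\ldots,p-1\}$, the substitution $\varphi_{S^i(B)}:\mathcal A^*\to\mathcal A^*$ (the case $i=0$ being $\varphi_B$) is the monoid endomorphism given on letters by \[\varphi_{S^i(B)}(n)=\begin{cases}0^{d_{i+n+1,n+1}}(n+1),&0\le n<\ell p+mp-1,\\ 0^{d_{i,\ell p+mp}}(\ell p),&n=\ell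 p+mp-1.\end{cases}\] Substitutions act on infinite words letter by letter (concatenating images). A substitution $\psi$ over a finite alphabet is primitive if some power $n\ge1$ of its incidence matrix $(M_\psi)_{a,b}=|\psi(b)|_a$ (number of occurrences of $a$ in $\psi(b)$) has only positive entries. *)

theory Defs
  imports
    "HOL-Analysis.Function_Topology"
    "HOL-Library.Stream"
    "Jordan_Normal_Form.Matrix"
begin

section \<open>Alternate bases and expansions\<close>

definition alternate_base :: "nat \<Rightarrow> (int \<Rightarrow> real) \<Rightarrow> bool" where
  "alternate_base p B \<longleftrightarrow> p \<ge> 1 \<and> (\<forall>n. B n > 1) \<and> (\<forall>n. B (n + int p) = B n)"

definition shift_base :: "int \<Rightarrow> (int \<Rightarrow> real) \<Rightarrow> int \<Rightarrow> real" where
  "shift_base N B = (\<lambda>n. B (n + N))"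

text \<open>The value \<^term>\<open>greedy_rem B N r k\<close> is the remainder with index \<open>N - k\<close> of the greedy
  algorithm started at index \<open>N\<close> with remainder \<open>r\<close>.\<close>

primrec greedy_rem :: "(int \<Rightarrow> real) \<Rightarrow> int \<Rightarrow> real \<Rightarrow> nat \<Rightarrow> real" where
  "greedy_rem B N r 0 = r"
| "greedy_rem B N r (Suc k) =
     B (N - int k) * greedy_rem B N r k
       - of_int \<lfloor>B (N - int k) * greedy_rem B N r k\<rfloor>"

definition greedy_digits :: "(int \<Rightarrow> real) \<Rightarrow> int \<Rightarrow> real \<Rightarrow> int \<Rightarrow> nat" where
  "greedy_digits B N r =
     (\<lambda>n. if n > N then 0 else nat \<lfloor>B n * greedy_rem B N r (nat (N - n))\<rfloor>)"

text \<open>The expansion is indexed by all integers, the digit with index \<open>n\<close> being the one of weight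
  \<open>B (n - 1) * \<dots> * B 0\<close> for \<open>n \<ge> 0\<close>. It is meaningful for \<open>x \<ge> 0\<close>.\<close>

definition expansion :: "(int \<Rightarrow> real) \<Rightarrow> real \<Rightarrow> int \<Rightarrow> nat" where
  "expansion B x =
     (if x < 1 then greedy_digits B (-1) x
      else let N = (LEAST N::nat. x < (\<Prod>i\<le>N. B (int i)))
           in greedy_digits B (int N) (x / (\<Prod>i\<le>N. B (int i))))"

definition B_integers :: "(int \<Rightarrow> real) \<Rightarrow> real set" where
  "B_integers B = {x. x \<ge> 0 \<and> (\<forall>n<0. expansion B x n = 0)}"

definition B_integer_seq :: "(int \<Rightarrow> real) \<Rightarrow> nat \<Rightarrow> real" where
  "B_integer_seq B = (THE x. strict_mono x \<and> range x = B_integers B)"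

definition w_seq :: "(int \<Rightarrow> real) \<Rightarrow> nat \<Rightarrow> nat" where
  "w_seq B k = (GREATEST n. expansion B (B_integer_seq B k) (int n)
                          \<noteq> expansion B (B_integer_seq B (Suc k)) (int n))"

text \<open>The limit is taken in the product topology on \<^typ>\<open>int \<Rightarrow> nat\<close>, with \<^typ>\<open>nat\<close> discrete.
  The digits of the quasi-greedy expansion of 1 are indexed by \<open>j \<ge> 1\<close>; the value at
  \<open>j = 0\<close> is irrelevant.\<close>

definition quasi_greedy :: "(int \<Rightarrow> real) \<Rightarrow> nat \<Rightarrow> nat" where
  "quasi_greedy B = (\<lambda>j. (THE a. (expansion B \<longlongrightarrow> a) (at_left 1)) (- int j))"

definition qg_digit :: "(int \<Rightarrow> real) \<Rightarrow> nat \<Rightarrow> nat \<Rightarrow> nat" where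
  "qg_digit B n = quasi_greedy (shift_base (int n) B)"

definition eventually_periodic :: "(nat \<Rightarrow> 'a) \<Rightarrow> bool" where
  "eventually_periodic a \<longleftrightarrow> (\<exists>q\<ge>1. \<exists>j0. \<forall>j>j0. a (j + q) = a j)"

definition parry :: "nat \<Rightarrow> (int \<Rightarrow> real) \<Rightarrow> bool" where
  "parry p B \<longleftrightarrow> (\<forall>i<p. eventually_periodic (qg_digit B i))"


section \<open>Substitutions\<close>

text \<open>Substitutions over the alphabet \<open>{0..<L}\<close> are functions on words over \<^typ>\<open>nat\<close>;
  only their values on words with letters below \<open>L\<close> matter.\<close>

definition substitution :: "nat \<Rightarrow> (nat list \<Rightarrow> nat list) \<Rightarrow> bool" where
  "substitution L \<psi> \<longleftrightarrow>
     (\<forall>u\<in>lists {0..<L}. \<psi> u \<in> lists {0..<L}) \<and>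
     \<psi> [] = [] \<and>
     (\<forall>u\<in>lists {0..<L}. \<forall>v\<in>lists {0..<L}. \<psi> (u @ v) = \<psi> u @ \<psi> v)"

definition incidence_matrix :: "nat \<Rightarrow> (nat list \<Rightarrow> nat list) \<Rightarrow> nat mat" where
  "incidence_matrix L \<psi> = mat L L (\<lambda>(a, b). count_list (\<psi> [b]) a)"

definition primitive_substitution :: "nat \<Rightarrow> (nat list \<Rightarrow> nat list) \<Rightarrow> bool" where
  "primitive_substitution L \<psi> \<longleftrightarrow> substitution L \<psi> \<and>
     (\<exists>n\<ge>1. \<forall>a<L. \<forall>b<L. (incidence_matrix L \<psi> ^\<^sub>m n) $$ (a, b) > 0)"

text \<open>Since \<^const>\<open>flat\<close> is the concatenation of a stream of words only when all of them are
  nonempty, this is the action on infinite words of non-erasing substitutions.\<close>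

definition apply_inf :: "(nat list \<Rightarrow> nat list) \<Rightarrow> nat stream \<Rightarrow> nat stream" where
  "apply_inf \<psi> v = flat (smap (\<lambda>a. \<psi> [a]) v)"

definition extend_word :: "(nat \<Rightarrow> nat list) \<Rightarrow> nat list \<Rightarrow> nat list" where
  "extend_word f u = concat (map f u)"


section \<open>The word and the substitutions attached to a Parry alternate base\<close>

definition v_word :: "nat \<Rightarrow> (int \<Rightarrow> real) \<Rightarrow> nat \<Rightarrow> nat \<Rightarrow> nat stream" where
  "v_word p B l m = smap (\<lambda>k. if w_seq B k < l * p then w_seq B k
                             else l * p + (w_seq B k - l * p) mod (m * p)) nats"

definition phi_letter :: "nat \<Rightarrow> (int \<Rightarrow> real) \<Rightarrow> nat \<Rightarrow> nat \<Rightarrow> nat \<Rightarrow> nat \<Rightarrow> nat list" where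
  "phi_letter p B l m i n =
     (if n < l * p + m * p - 1
      then replicate (qg_digit B (i + n + 1) (n + 1)) 0 @ [n + 1]
      else replicate (qg_digit B i (l * p + m * p)) 0 @ [l * p])"

definition phi :: "nat \<Rightarrow> (int \<Rightarrow> real) \<Rightarrow> nat \<Rightarrow> nat \<Rightarrow> nat \<Rightarrow> nat list \<Rightarrow> nat list" where
  "phi p B l m i = extend_word (phi_letter p B l m i)"

text \<open>This is \<open>phi 0 \<circ> phi 1 \<circ> \<dots> \<circ> phi (p - 1)\<close>, so that \<open>phi (p - 1)\<close> is applied first.\<close>

definition phi_comp :: "nat \<Rightarrow> (int \<Rightarrow> real) \<Rightarrow> nat \<Rightarrow> nat \<Rightarrow> nat list \<Rightarrow> nat list" where
  "phi_comp p B l m = foldr (\<circ>) (map (phi p B l m) [0..<p]) id"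

end

theory Submission
  imports Defs
begin

text \<open>Write \<open>S B\<close> for the base \<open>B\<close> shifted by 1. Multiplying by \<open>B 0\<close> appends a digit 0, so each
  \<open>S B\<close>-integer \<open>y\<close> gives rise to a block of \<open>B\<close>-integers \<open>B 0 * y + c\<close>, where \<open>c\<close> ranges over the
  digits that can be appended to the expansion of \<open>y\<close>. By monotonicity of greedy expansions these
  are exactly the \<open>c\<close> with \<open>B 0 * y + c < B 0 * y'\<close> for the successor \<open>y'\<close> of \<open>y\<close>, so their number
  depends only on the gap \<open>y' - y\<close>. If \<open>n\<close> is the greatest index at which the expansions of \<open>y\<close> and
  \<open>y'\<close> differ, induction on \<open>n\<close> shows that the gap is the remainder after \<open>n\<close> steps of the
  quasi-greedy algorithm for the base \<open>S B\<close> shifted by \<open>n\<close> (\<open>consecutive_gap\<close>). One more step of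
  that algorithm yields the greatest admissible \<open>c\<close>, namely the quasi-greedy digit with number
  \<open>n + 1\<close> for \<open>B\<close> shifted by \<open>n + 1\<close>. Hence the sequence of greatest differing indices of \<open>B\<close> arises
  from that of \<open>S B\<close> by replacing every \<open>n\<close> with that many zeros followed by \<open>n + 1\<close>
  (\<open>w_seq_prefix_image\<close>).

  Periodicity of the quasi-greedy expansions makes this infinite substitution compatible with the
  projection onto the finite alphabet (\<open>phi_letter_proj\<close>). Composing over one period of \<open>B\<close> returns
  to \<open>B\<close> and maps arbitrarily long prefixes of the word to prefixes that are at least as long, so
  the word is fixed (\<open>v_word_fixed\<close>).

  For primitivity, the letters descending from a letter \<open>b\<close> run through the digits of a single
  quasi-greedy expansion, which has infinitely many nonzero digits, so that a letter 0 is produced;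
  from 0 all letters arise, and 0 persists (\<open>primitive_phi_comp\<close>).\<close>


section \<open>Greedy digit strings\<close>

text \<open>Everything up to the substitutions only needs the base to be bounded away from 1;
  unlike \<^const>\<open>alternate_base\<close>, this notion makes no reference to a period.\<close>

definition uniform_base :: "(int \<Rightarrow> real) \<Rightarrow> bool" where
  "uniform_base B \<longleftrightarrow> (\<exists>b>1. \<forall>n. b \<le> B n)"

text \<open>The weight \<open>B (n - 1) * \<dots> * B 0\<close> of the digit with index \<open>n\<close>.\<close>

definition weight :: "(int \<Rightarrow> real) \<Rightarrow> nat \<Rightarrow> real" where
  "weight B n = (\<Prod>i<n. B (int i))"

text \<open>The contribution of the digits with indices below \<open>n\<close>.\<close>

definition low_value :: "(int \<Rightarrow> real) \<Rightarrow> (nat \<Rightarrow> nat) \<Rightarrow> nat \<Rightarrow> real" where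
  "low_value B s n = (\<Sum>i<n. real (s i) * weight B i)"

text \<open>The string \<open>s\<close> of digits with nonnegative indices and the fractional part \<open>f\<close> represent
  \<open>z\<close> greedily: the part below each index \<open>n\<close> is smaller than the weight of \<open>n\<close>. When all weights are
  positive, the last condition says at once that \<open>s\<close> is finitely supported and that its value
  plus \<open>f\<close> is \<open>z\<close>.\<close>

definition greedy_rep :: "(int \<Rightarrow> real) \<Rightarrow> real \<Rightarrow> (nat \<Rightarrow> nat) \<Rightarrow> real \<Rightarrow> bool" where
  "greedy_rep B z s f \<longleftrightarrow> 0 \<le> f \<and> (\<forall>n. low_value B s n + f < weight B n) \<and>
     (\<forall>\<^sub>F n in sequentially. low_value B s n + f = z)"

text \<open>The digits of the expansion before the radix point.\<close>

definition digits :: "(int \<Rightarrow> real) \<Rightarrow> real \<Rightarrow> nat \<Rightarrow> nat" where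
  "digits B z n = expansion B z (int n)"

text \<open>The strings differ at index \<open>n\<close> and agree at all greater indices.\<close>

definition top_diff :: "(nat \<Rightarrow> nat) \<Rightarrow> (nat \<Rightarrow> nat) \<Rightarrow> nat \<Rightarrow> bool" where
  "top_diff s t n \<longleftrightarrow> s n \<noteq> t n \<and> (\<forall>m>n. s m = t m)"

lemma uniform_base_gt_1: "uniform_base B \<Longrightarrow> 1 < B n"
  unfolding uniform_base_def by (meson less_le_trans)

lemma uniform_base_pos: "uniform_base B \<Longrightarrow> 0 < B n"
  using uniform_base_gt_1[of B n] by simp

lemma uniform_base_shift: "uniform_base B \<Longrightarrow> uniform_base (shift_base N B)"
  unfolding uniform_base_def shift_base_def by blast

lemma shift_base_shift_base: "shift_base M (shift_base N B) = shift_base (M + N) B"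
  by (simp add: shift_base_def add.assoc)

lemma alternate_base_periodic:
  assumes "alternate_base p B"
  shows "B (n + k * int p) = B n"
proof (induction k rule: int_induct[of _ 0])
  case (step1 i)
  have "B (n + (i + 1) * int p) = B ((n + i * int p) + int p)"
    by (simp add: algebra_simps)
  then show ?case
    using assms step1 unfolding alternate_base_def by simp
next
  case (step2 i)
  have "B (n + i * int p) = B ((n + (i - 1) * int p) + int p)"
    by (simp add: algebra_simps)
  then show ?case
    using assms step2 unfolding alternate_base_def by simp
qed simp

lemma alternate_base_mod:
  assumes "alternate_base p B"
  shows "B (n mod int p) = B n"
  using alternate_base_periodic[OF assms, of "n mod int p" "n div int p"] by simp

lemma alternate_base_uniform:
  assumes "alternate_base p B"
  shows "uniform_base B"
proof -
  have p: "p \<ge> 1" and gt: "\<And>n. B n > 1"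
    using assms unfolding alternate_base_def by auto
  define b where "b = Min (B ` {0..<int p})"
  have fin: "finite (B ` {0..<int p})" "B ` {0..<int p} \<noteq> {}"
    using p by auto
  have "b > 1"
    unfolding b_def using fin gt by (subst Min_gr_iff) auto
  moreover have "b \<le> B n" for n
  proof -
    have "B (n mod int p) \<in> B ` {0..<int p}"
      using p by simp
    then show ?thesis
      unfolding b_def alternate_base_mod[OF assms, of n, symmetric] using fin by (intro Min_le) auto
  qed
  ultimately show ?thesis
    unfolding uniform_base_def by blast
qed

lemma weight_0 [simp]: "weight B 0 = 1"
  by (simp add: weight_def)

lemma weight_Suc: "weight B (Suc n) = weight B n * B (int n)"
  by (simp add: weight_def)

lemma low_value_0 [simp]: "low_value B s 0 = 0"
  by (simp add: low_value_def)

lemma low_value_Suc: "low_value B s (Suc n) = low_value B s n + real (s n) * weight B n"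
  by (simp add: low_value_def)

lemma weight_pos: "uniform_base B \<Longrightarrow> 0 < weight B n"
  unfolding weight_def by (intro prod_pos) (auto simp: uniform_base_pos)

lemma strict_mono_weight: "uniform_base B \<Longrightarrow> strict_mono (weight B)"
  using weight_pos[of B] uniform_base_gt_1[of B]
  by (simp add: strict_mono_Suc_iff weight_Suc)

lemma weight_unbounded:
  assumes "uniform_base B"
  obtains n where "z < weight B n"
proof -
  obtain b where b: "b > 1" "\<And>n. b \<le> B n"
    using assms unfolding uniform_base_def by blast
  obtain n where n: "z < b ^ n"
    using real_arch_pow[OF b(1)] by blast
  have "b ^ n = (\<Prod>i<n. b)" by simp
  also have "\<dots> \<le> weight B n"
    unfolding weight_def using b by (intro prod_mono) (auto intro: order.trans[of 0 1])
  finally have "z < weight B n" using n by simp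
  then show ?thesis by (rule that)
qed

lemma weight_shift: "weight B (Suc n) = B 0 * weight (shift_base 1 B) n"
proof (induction n)
  case (Suc n)
  then show ?case
    by (simp add: weight_Suc[of B "Suc n"] weight_Suc[of "shift_base 1 B" n])
      (simp add: shift_base_def add.commute)
qed (simp add: weight_def)

lemma low_value_shift:
  "low_value B s (Suc n) = real (s 0) + B 0 * low_value (shift_base 1 B) (s \<circ> Suc) n"
proof (induction n)
  case (Suc n)
  then show ?case
    by (simp add: low_value_Suc[of B s "Suc n"] low_value_Suc[of "shift_base 1 B"] weight_shift
        algebra_simps)
qed (simp add: low_value_def)

lemma low_value_nonneg: "uniform_base B \<Longrightarrow> 0 \<le> low_value B s n"
  unfolding low_value_def by (intro sum_nonneg mult_nonneg_nonneg) (auto simp: weight_pos less_imp_le)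

lemma low_value_mono: "uniform_base B \<Longrightarrow> m \<le> n \<Longrightarrow> low_value B s m \<le> low_value B s n"
  unfolding low_value_def by (intro sum_mono2) (auto simp: weight_pos less_imp_le)

lemma greedy_rep_value_ge:
  assumes "uniform_base B" "greedy_rep B z s f"
  shows "low_value B s n + f \<le> z"
proof -
  have "\<forall>\<^sub>F m in sequentially. low_value B s m + f = z \<and> m \<ge> n"
    using assms(2) eventually_ge_at_top[of n] unfolding greedy_rep_def by (intro eventually_conj) auto
  then obtain m where "low_value B s m + f = z" "m \<ge> n"
    using eventually_happens by force
  then show ?thesis using low_value_mono[OF assms(1), of n m s] by simp
qed

lemma greedy_rep_digit_bound:
  assumes "uniform_base B" "greedy_rep B z s f"
  shows "real (s n) < B (int n)"
proof -
  have "real (s n) * weight B n \<le> low_value B s (Suc n) + f"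
    using low_value_nonneg[OF assms(1), of s n] assms(2) by (simp add: low_value_Suc greedy_rep_def)
  also have "\<dots> < B (int n) * weight B n"
    using assms(2) weight_Suc[of B n] unfolding greedy_rep_def by (metis mult.commute)
  finally show ?thesis using weight_pos[OF assms(1)] by simp
qed

lemma greedy_rep_digit_zero:
  assumes "uniform_base B" "greedy_rep B z s f" "z < weight B n" "n \<le> k"
  shows "s k = 0"
proof (rule ccontr)
  assume "s k \<noteq> 0"
  then have "weight B k \<le> real (s k) * weight B k"
    using weight_pos[OF assms(1), of k] by simp
  then have "weight B n \<le> real (s k) * weight B k"
    using strict_mono_less_eq[OF strict_mono_weight[OF assms(1)], of n k] assms(4) by simp
  also have "\<dots> \<le> low_value B s (Suc k) + f"
    using low_value_nonneg[OF assms(1), of s k] assms(2) by (simp add: low_value_Suc greedy_rep_def)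
  also have "\<dots> \<le> z"
    by (rule greedy_rep_value_ge[OF assms(1,2)])
  finally show False using assms(3) by simp
qed

lemma greedy_rep_eventually_zero:
  assumes "uniform_base B" "greedy_rep B z s f"
  shows "\<exists>N. \<forall>n\<ge>N. s n = 0"
proof -
  obtain N where "z < weight B N"
    using weight_unbounded[OF assms(1)] .
  then show ?thesis
    using greedy_rep_digit_zero[OF assms] by blast
qed

text \<open>Removing the digit with index 0 and moving the radix point relates greedy representations
  for \<open>B\<close> to those for the shifted base; the removed digit goes into the fractional part. All
  recursions below come from this equivalence.\<close>

lemma greedy_rep_shift:
  assumes "uniform_base B"
  shows "greedy_rep B z s f \<longleftrightarrow> 0 \<le> f \<and> f < 1 \<and>
    greedy_rep (shift_base 1 B) (z / B 0) (s \<circ> Suc) ((real (s 0) + f) / B 0)"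
proof -
  have B0: "B 0 > 0" using uniform_base_pos[OF assms] .
  have "(\<forall>n. low_value B s n + f < weight B n) \<longleftrightarrow>
      f < 1 \<and> (\<forall>n. low_value B s (Suc n) + f < weight B (Suc n))"
    using not0_implies_Suc by (metis add_0 low_value_0 weight_0)
  moreover have "low_value B s (Suc n) + f < weight B (Suc n) \<longleftrightarrow>
      low_value (shift_base 1 B) (s \<circ> Suc) n + (real (s 0) + f) / B 0 < weight (shift_base 1 B) n" for n
    unfolding low_value_shift weight_shift using B0 by (simp add: field_simps)
  moreover have "(\<forall>\<^sub>F n in sequentially. low_value B s n + f = z) \<longleftrightarrow>
      (\<forall>\<^sub>F n in sequentially. low_value B s (Suc n) + f = z)"
    using eventually_sequentially_Suc[of "\<lambda>n. low_value B s n + f = z"] by simp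
  moreover have "low_value B s (Suc n) + f = z \<longleftrightarrow>
      low_value (shift_base 1 B) (s \<circ> Suc) n + (real (s 0) + f) / B 0 = z / B 0" for n
    unfolding low_value_shift using B0 by (simp add: field_simps)
  moreover have "0 \<le> f \<Longrightarrow> 0 \<le> (real (s 0) + f) / B 0"
    using B0 by simp
  ultimately show ?thesis
    unfolding greedy_rep_def by auto
qed

text \<open>Greedy representations are ordered like their digit strings, compared from the greatest
  index downwards, whatever the fractional parts are.\<close>

lemma greedy_rep_lex_less:
  assumes B: "uniform_base B" and s: "greedy_rep B z s f" and t: "greedy_rep B y t g"
    and diff: "top_diff s t n" "s n < t n"
  shows "z < y"
proof -
  have "\<forall>\<^sub>F k in sequentially. low_value B s k + f = z \<and> low_value B t k + g = y \<and> k \<ge> Suc n"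
    using s t eventually_ge_at_top[of "Suc n"] unfolding greedy_rep_def by (intro eventually_conj) auto
  then obtain k where k: "low_value B s k + f = z" "low_value B t k + g = y" "k \<ge> Suc n"
    using eventually_happens by force
  have split: "low_value B u k = low_value B u n + real (u n) * weight B n
      + (\<Sum>i\<in>{Suc n..<k}. real (u i) * weight B i)" for u
  proof -
    have "low_value B u k = low_value B u (Suc n) + (\<Sum>i\<in>{Suc n..<k}. real (u i) * weight B i)"
      unfolding low_value_def lessThan_atLeast0 using k(3)
      by (subst sum.atLeastLessThan_concat) auto
    then show ?thesis by (simp add: low_value_Suc)
  qed
  have high: "(\<Sum>i\<in>{Suc n..<k}. real (s i) * weight B i) = (\<Sum>i\<in>{Suc n..<k}. real (t i) * weight B i)"
    using diff(1) by (intro sum.cong) (auto simp: top_diff_def)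
  have "low_value B s n + f + real (s n) * weight B n < (real (s n) + 1) * weight B n"
    using s by (simp add: greedy_rep_def algebra_simps)
  also have "\<dots> \<le> real (t n) * weight B n"
    using diff(2) weight_pos[OF B, of n] by (intro mult_right_mono) auto
  also have "\<dots> \<le> low_value B t n + g + real (t n) * weight B n"
    using low_value_nonneg[OF B, of t n] t by (simp add: greedy_rep_def)
  finally show ?thesis
    using k(1,2) split[of s] split[of t] high by linarith
qed

lemma top_diff_commute: "top_diff s t n \<longleftrightarrow> top_diff t s n"
  unfolding top_diff_def by metis

lemma top_diff_exists:
  assumes "\<exists>N. \<forall>n\<ge>N. s n = 0" "\<exists>N. \<forall>n\<ge>N. t n = 0" "s \<noteq> t"
  obtains n where "top_diff s t n"
proof -
  obtain N M where NM: "\<forall>n\<ge>N. s n = 0" "\<forall>n\<ge>M. t n = 0"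
    using assms(1,2) by blast
  define A where "A = {n. s n \<noteq> t n}"
  have "A \<subseteq> {..<max N M}"
  proof
    fix x assume "x \<in> A"
    then have "\<not> (N \<le> x \<and> M \<le> x)" using NM unfolding A_def by auto
    then show "x \<in> {..<max N M}" by auto
  qed
  then have "finite A" by (rule finite_subset) simp
  moreover have "A \<noteq> {}" using assms(3) unfolding A_def by auto
  ultimately have "Max A \<in> A" "\<And>n. n \<in> A \<Longrightarrow> n \<le> Max A" by auto
  then have "top_diff s t (Max A)"
    unfolding top_diff_def A_def by (auto simp: not_less[symmetric])
  then show ?thesis by (rule that)
qed

lemma greedy_rep_top_diff:
  assumes "uniform_base B" "greedy_rep B z s f" "greedy_rep B y t g" "s \<noteq> t"
  obtains n where "top_diff s t n"
  using top_diff_exists greedy_rep_eventually_zero assms by metis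

lemma greedy_rep_less_top_diff:
  assumes "uniform_base B" "greedy_rep B z s f" "greedy_rep B y t g" "top_diff s t n" "z < y"
  shows "s n < t n"
proof (rule ccontr)
  assume "\<not> s n < t n"
  then have "t n < s n" using assms(4) by (auto simp: top_diff_def)
  then have "y < z"
    using greedy_rep_lex_less[OF assms(1,3,2)] assms(4) top_diff_commute by blast
  then show False using assms(5) by simp
qed

lemma greedy_rep_same_digits:
  assumes "greedy_rep B z s f" "greedy_rep B y s g"
  shows "z - f = y - g"
proof -
  have "\<forall>\<^sub>F n in sequentially. low_value B s n + f = z \<and> low_value B s n + g = y"
    using assms unfolding greedy_rep_def by (intro eventually_conj) auto
  then obtain n where "low_value B s n + f = z" "low_value B s n + g = y"
    using eventually_happens by force
  then show ?thesis by simp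
qed

lemma greedy_rep_unique:
  assumes "uniform_base B" "greedy_rep B z s f" "greedy_rep B z t g"
  shows "s = t" "f = g"
proof -
  show st: "s = t"
  proof (rule ccontr)
    assume "s \<noteq> t"
    then obtain n where n: "top_diff s t n"
      using greedy_rep_top_diff[OF assms] by blast
    then have "s n < t n \<or> t n < s n" by (auto simp: top_diff_def)
    then show False
      using greedy_rep_lex_less[OF assms(1,2,3) n] greedy_rep_lex_less[OF assms(1,3,2)] n
      by (auto simp: top_diff_commute)
  qed
  show "f = g"
    using greedy_rep_same_digits assms(2,3) unfolding st by fastforce
qed

lemma greedy_rep_smaller_fraction:
  assumes "greedy_rep B z s f" "0 \<le> g" "g \<le> f"
  shows "greedy_rep B (z - f + g) s g"
  unfolding greedy_rep_def
proof (intro conjI allI)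
  fix n
  have "low_value B s n + f < weight B n"
    using assms unfolding greedy_rep_def by auto
  then show "low_value B s n + g < weight B n" using assms by simp
  show "\<forall>\<^sub>F n in sequentially. low_value B s n + g = z - f + g"
    using assms unfolding greedy_rep_def by (auto elim: eventually_mono)
qed (rule assms)


section \<open>Expansions and their integer parts\<close>

text \<open>Both branches of \<^const>\<open>expansion\<close> are instances of the greedy algorithm started just below
  an index \<open>N\<close> whose weight exceeds \<open>z\<close>; the branch for \<open>z < 1\<close> is \<open>N = 0\<close>.\<close>

lemma expansion_eq_greedy_digits:
  assumes "uniform_base B" "0 \<le> z"
  obtains N where "z < weight B N" "expansion B z = greedy_digits B (int N - 1) (z / weight B N)"
proof (cases "z < 1")
  case True
  then show ?thesis
    by (intro that[of 0]) (simp_all add: expansion_def)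
next
  case False
  have weight_atMost: "(\<Prod>i\<le>M. B (int i)) = weight B (Suc M)" for M :: nat
    by (simp add: weight_def lessThan_Suc_atMost)
  define N where "N = (LEAST N. z < weight B (Suc N))"
  obtain M where "z < weight B M" using weight_unbounded[OF assms(1)] .
  then have "z < weight B (Suc M)"
    using strict_monoD[OF strict_mono_weight[OF assms(1)], of M "Suc M"] by simp
  then have "z < weight B (Suc N)"
    unfolding N_def by (rule LeastI)
  then show ?thesis
    using False by (intro that[of "Suc N"]) (simp_all add: expansion_def weight_atMost N_def Let_def)
qed

lemma greedy_rem_range:
  assumes "0 \<le> r" "r < 1"
  shows "0 \<le> greedy_rem B N r k \<and> greedy_rem B N r k < 1"
  using assms by (cases k) (auto, linarith)

text \<open>The digits before the radix point form a greedy representation, and the fractional part that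
  remains generates the digits after it.\<close>

lemma expansion_greedy_rep:
  assumes B: "uniform_base B" and z: "0 \<le> z"
  obtains f where "greedy_rep B z (digits B z) f"
    "\<And>k. expansion B z (- 1 - int k) = nat \<lfloor>B (- 1 - int k) * greedy_rem B (- 1) f k\<rfloor>"
proof -
  obtain N where N: "z < weight B N"
    and ex: "expansion B z = greedy_digits B (int N - 1) (z / weight B N)"
    using expansion_eq_greedy_digits[OF B z] .
  define r where "r k = greedy_rem B (int N - 1) (z / weight B N) k" for k
  have r_range: "0 \<le> r k" "r k < 1" for k
    using greedy_rem_range[of "z / weight B N" B "int N - 1" k] N z weight_pos[OF B, of N]
    unfolding r_def by auto
  have r_Suc: "r (Suc k) = B (int N - 1 - int k) * r k - of_int \<lfloor>B (int N - 1 - int k) * r k\<rfloor>" for k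
    unfolding r_def by simp
  have digit: "real (digits B z n) = of_int \<lfloor>B (int n) * r (N - Suc n)\<rfloor>" if "n < N" for n
  proof -
    have "nat (int N - 1 - int n) = N - Suc n" using that by simp
    moreover have "0 \<le> B (int n) * r (N - Suc n)"
      using uniform_base_pos[OF B, of "int n"] r_range by simp
    ultimately show ?thesis
      using that unfolding digits_def ex greedy_digits_def r_def by simp
  qed
  have digit_high: "digits B z n = 0" if "n \<ge> N" for n
    using that unfolding digits_def ex greedy_digits_def by simp
  \<comment> \<open>The tail below index n equals the greedy remainder at that stage, scaled by the weight of n.\<close>
  have low: "low_value B (digits B z) n + r N = r (N - n) * weight B n" if "n \<le> N" for n
    using that
  proof (induction n)
    case (Suc n)
    have idx: "N - n = Suc (N - Suc n)" "int N - 1 - int (N - Suc n) = int n" using Suc.prems by auto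
    have rem: "r (N - n) = B (int n) * r (N - Suc n) - real (digits B z n)"
      using r_Suc[of "N - Suc n"] digit[of n] Suc.prems unfolding idx by simp
    have "low_value B (digits B z) (Suc n) + r N = (r (N - n) + real (digits B z n)) * weight B n"
      using Suc by (simp add: low_value_Suc algebra_simps)
    also have "\<dots> = r (N - Suc n) * weight B (Suc n)"
      unfolding rem by (simp add: weight_Suc)
    finally show ?case .
  qed simp
  have high: "low_value B (digits B z) n + r N = z" if "n \<ge> N" for n
    using that
  proof (induction n rule: dec_induct)
    case base
    show ?case using low[of N] weight_pos[OF B, of N] by (simp add: r_def)
  next
    case (step n)
    then show ?case by (simp add: low_value_Suc digit_high)
  qed
  have "low_value B (digits B z) n + r N < weight B n" for n
  proof (cases "n \<le> N")
    case True
    then show ?thesis using low r_range(2)[of "N - n"] weight_pos[OF B, of n] by simp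
  next
    case False
    then show ?thesis
      using high[of n] N strict_monoD[OF strict_mono_weight[OF B], of N n] by simp
  qed
  moreover have "\<forall>\<^sub>F n in sequentially. low_value B (digits B z) n + r N = z"
    using high by (auto simp: eventually_sequentially)
  ultimately have rep: "greedy_rep B z (digits B z) (r N)"
    unfolding greedy_rep_def using r_range by simp
  have rem: "greedy_rem B (- 1) (r N) k = r (N + k)" for k
  proof (induction k)
    case (Suc k)
    have "int N - 1 - int (N + k) = - 1 - int k" by simp
    then show ?case using Suc r_Suc[of "N + k"] by simp
  qed simp
  have "expansion B z (- 1 - int k) = nat \<lfloor>B (- 1 - int k) * greedy_rem B (- 1) (r N) k\<rfloor>" for k
  proof -
    have "nat (int N - 1 - (- 1 - int k)) = N + k" by simp
    then show ?thesis
      unfolding ex greedy_digits_def rem by (simp add: r_def)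
  qed
  then show ?thesis using that rep by blast
qed

text \<open>If no nonzero digit occurs, each step multiplies the remainder by at least some \<open>b > 1\<close>, so
  a positive remainder would leave the unit interval.\<close>

lemma greedy_rem_no_digits:
  assumes B: "uniform_base B" and f: "0 \<le> f" "f < 1"
    and zero: "\<And>k. nat \<lfloor>B (- 1 - int k) * greedy_rem B (- 1) f k\<rfloor> = 0"
  shows "f = 0"
proof (rule ccontr)
  assume "f \<noteq> 0"
  then have "f > 0" using f by simp
  obtain b where b: "b > 1" "\<And>n. b \<le> B n"
    using B unfolding uniform_base_def by blast
  have grow: "b ^ k * f \<le> greedy_rem B (- 1) f k" for k
  proof (induction k)
    case (Suc k)
    have ge: "0 \<le> greedy_rem B (- 1) f k" using greedy_rem_range[OF f] by blast
    have "0 \<le> B (- 1 - int k) * greedy_rem B (- 1) f k"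
      using ge uniform_base_pos[OF B, of "- 1 - int k"] by simp
    then have "\<lfloor>B (- 1 - int k) * greedy_rem B (- 1) f k\<rfloor> = 0"
      using zero[of k] by (metis nat_eq_iff2 zero_le_floor of_nat_0)
    then have "greedy_rem B (- 1) f (Suc k) = B (- 1 - int k) * greedy_rem B (- 1) f k"
      by simp
    also have "\<dots> \<ge> b * (b ^ k * f)"
      using Suc b ge \<open>f > 0\<close> uniform_base_pos[OF B] by (intro mult_mono) (auto simp: less_imp_le)
    finally show ?case by (simp add: mult.assoc)
  qed simp
  obtain k where "1 / f < b ^ k" using real_arch_pow[OF b(1)] by blast
  then have "1 < b ^ k * f" using \<open>f > 0\<close> by (simp add: divide_less_eq)
  then show False
    using greedy_rem_range[OF f, of B "- 1" k] grow[of k] by linarith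
qed

lemma greedy_rep_digits:
  assumes "uniform_base B" "greedy_rep B z s f"
  shows "digits B z = s"
proof -
  have "0 \<le> z"
    using greedy_rep_value_ge[OF assms, of 0] assms(2) by (simp add: greedy_rep_def)
  then obtain g where "greedy_rep B z (digits B z) g"
    using expansion_greedy_rep[OF assms(1)] by blast
  then show ?thesis using greedy_rep_unique[OF assms(1)] assms(2) by blast
qed

lemma B_integers_iff:
  assumes B: "uniform_base B"
  shows "z \<in> B_integers B \<longleftrightarrow> greedy_rep B z (digits B z) 0"
proof (cases "0 \<le> z")
  case True
  obtain f where f: "greedy_rep B z (digits B z) f"
    and ex: "\<And>k. expansion B z (- 1 - int k) = nat \<lfloor>B (- 1 - int k) * greedy_rem B (- 1) f k\<rfloor>"
    using expansion_greedy_rep[OF B True] by blast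
  have frange: "0 \<le> f" "f < 1"
    using f greedy_rep_shift[OF B, of z "digits B z" f] by blast+
  have "z \<in> B_integers B \<longleftrightarrow> (\<forall>k. expansion B z (- 1 - int k) = 0)"
  proof
    assume *: "\<forall>k. expansion B z (- 1 - int k) = 0"
    have "expansion B z n = 0" if "n < 0" for n
      using *[rule_format, of "nat (- 1 - n)"] that by simp
    then show "z \<in> B_integers B" using True unfolding B_integers_def by simp
  qed (simp add: B_integers_def)
  also have "\<dots> \<longleftrightarrow> f = 0"
  proof
    assume "f = 0"
    then have "greedy_rem B (- 1) f k = 0" for k by (induction k) auto
    then show "\<forall>k. expansion B z (- 1 - int k) = 0" using ex by simp
  next
    assume "\<forall>k. expansion B z (- 1 - int k) = 0"
    then show "f = 0"
      by (intro greedy_rem_no_digits[OF B frange]) (simp flip: ex)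
  qed
  also have "\<dots> \<longleftrightarrow> greedy_rep B z (digits B z) 0"
    using f greedy_rep_unique(2)[OF B f, of "digits B z" 0] by blast
  finally show ?thesis .
next
  case False
  then have "\<not> greedy_rep B z (digits B z) 0"
    using greedy_rep_value_ge[OF B, of z "digits B z" 0 0] by auto
  then show ?thesis using False by (simp add: B_integers_def)
qed

lemma B_integersI:
  assumes "uniform_base B" "greedy_rep B z s 0"
  shows "z \<in> B_integers B"
  using assms B_integers_iff greedy_rep_digits by metis

section \<open>The quasi-greedy expansion of 1\<close>

text \<open>The remainders of the quasi-greedy algorithm for 1, in which \<open>\<lceil>x\<rceil> - 1\<close> replaces \<open>\<lfloor>x\<rfloor>\<close>.
  They stay in \<open>{0<..1}\<close>.\<close>

primrec qg_rem :: "(int \<Rightarrow> real) \<Rightarrow> nat \<Rightarrow> real" where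
  "qg_rem B 0 = 1"
| "qg_rem B (Suc k) = B (- 1 - int k) * qg_rem B k - of_int (\<lceil>B (- 1 - int k) * qg_rem B k\<rceil> - 1)"

lemma qg_rem_range: "0 < qg_rem B k \<and> qg_rem B k \<le> 1"
proof (cases k)
  case (Suc j)
  show ?thesis unfolding Suc qg_rem.simps by (simp; linarith)
qed simp

text \<open>For each fixed \<open>k\<close>, as \<open>t\<close> tends to 1 from below, the greedy remainders of \<open>t\<close> approach the
  quasi-greedy ones from below, at a distance proportional to \<open>1 - t\<close>. Rounding down a number
  slightly smaller than \<open>x\<close> gives \<open>\<lceil>x\<rceil> - 1\<close>.\<close>

lemma greedy_digits_near_1:
  assumes B: "uniform_base B"
  shows "\<forall>\<^sub>F t in at_left 1.
    greedy_rem B (- 1) t k = qg_rem B k - (1 - t) * (\<Prod>i<k. B (- 1 - int i)) \<and>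
    \<lfloor>B (- 1 - int k) * greedy_rem B (- 1) t k\<rfloor> = \<lceil>B (- 1 - int k) * qg_rem B k\<rceil> - 1"
proof (induction k)
  have digit: "\<forall>\<^sub>F t in at_left 1.
      \<lfloor>B (- 1 - int k) * (qg_rem B k - (1 - t) * (\<Prod>i<k. B (- 1 - int i)))\<rfloor> =
      \<lceil>B (- 1 - int k) * qg_rem B k\<rceil> - 1" for k
  proof -
    define c where "c = B (- 1 - int k) * (\<Prod>i<k. B (- 1 - int i))"
    define a where "a = B (- 1 - int k) * qg_rem B k"
    have "c > 0"
      unfolding c_def by (intro mult_pos_pos prod_pos) (auto simp: uniform_base_pos[OF B])
    have "\<forall>\<^sub>F t in at_left 1. 1 - t < (a - of_int (\<lceil>a\<rceil> - 1)) / c"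
    proof (rule order_tendstoD(2))
      show "((\<lambda>t. 1 - t) \<longlongrightarrow> 1 - 1) (at_left (1::real))"
        by (intro tendsto_intros)
      show "1 - 1 < (a - of_int (\<lceil>a\<rceil> - 1)) / c"
      proof -
        have "0 < a - of_int (\<lceil>a\<rceil> - 1)" by linarith
        then show ?thesis using \<open>c > 0\<close> by simp
      qed
    qed
    moreover have "\<forall>\<^sub>F t in at_left 1. t < (1::real)"
      by (simp add: eventually_at_filter)
    ultimately show ?thesis
    proof eventually_elim
      case (elim t)
      have "(1 - t) * c < a - of_int (\<lceil>a\<rceil> - 1)" "0 < (1 - t) * c"
        using elim \<open>c > 0\<close> by (simp_all add: pos_less_divide_eq)
      then have "\<lfloor>a - (1 - t) * c\<rfloor> = \<lceil>a\<rceil> - 1"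
        by linarith
      then show ?case
        unfolding a_def c_def by (simp add: algebra_simps)
    qed
  qed
  case 0
  show ?case using digit[of 0] by simp
  case (Suc k)
  show ?case using Suc digit[of "Suc k"]
  proof eventually_elim
    case (elim t)
    have "greedy_rem B (- 1) t (Suc k) =
        B (- 1 - int k) * (qg_rem B k - (1 - t) * (\<Prod>i<k. B (- 1 - int i)))
          - of_int (\<lceil>B (- 1 - int k) * qg_rem B k\<rceil> - 1)"
      by (subst greedy_rem.simps(2), subst elim(1)[THEN conjunct2], subst elim(1)[THEN conjunct1])
        (rule refl)
    also have "\<dots> = qg_rem B (Suc k) - (1 - t) * (\<Prod>i<Suc k. B (- 1 - int i))"
      by (simp add: algebra_simps)
    finally show ?case using elim(2) by simp
  qed
qed

text \<open>Convergence in the product topology with discrete factors.\<close>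

lemma tendsto_fun_iff_eventually:
  fixes f :: "'a \<Rightarrow> 'i \<Rightarrow> nat"
  shows "(f \<longlongrightarrow> l) F \<longleftrightarrow> (\<forall>i. \<forall>\<^sub>F x in F. f x i = l i)"
proof -
  have "(f \<longlongrightarrow> l) F \<longleftrightarrow> limitin (product_topology (\<lambda>i. euclidean) UNIV) f l F"
    unfolding euclidean_product_topology by simp
  also have "\<dots> \<longleftrightarrow> (\<forall>i. ((\<lambda>x. f x i) \<longlongrightarrow> l i) F)"
    by (simp add: limitin_componentwise)
  also have "\<dots> \<longleftrightarrow> (\<forall>i. \<forall>\<^sub>F x in F. f x i = l i)"
    by (simp add: tendsto_discrete)
  finally show ?thesis .
qed

lemma quasi_greedy_Suc:
  assumes B: "uniform_base B"
  shows "quasi_greedy B (Suc k) = nat (\<lceil>B (- 1 - int k) * qg_rem B k\<rceil> - 1)"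
proof -
  define a where "a n = (if n \<ge> 0 then 0
    else let k = nat (- 1 - n) in nat (\<lceil>B (- 1 - int k) * qg_rem B k\<rceil> - 1))" for n :: int
  have lim: "(expansion B \<longlongrightarrow> a) (at_left 1)"
    unfolding tendsto_fun_iff_eventually
  proof
    fix n
    have "\<forall>\<^sub>F t in at_left 1. t < (1::real)"
      by (simp add: eventually_at_filter)
    then show "\<forall>\<^sub>F t in at_left 1. expansion B t n = a n"
      using greedy_digits_near_1[OF B, of "nat (- 1 - n)"]
    proof eventually_elim
      case (elim t)
      show ?case
      proof (cases "n \<ge> 0")
        case True
        then show ?thesis
          using elim(1) by (simp add: expansion_def greedy_digits_def a_def)
      next
        case False
        define j where "j = nat (- 1 - n)"
        have n: "n = - 1 - int j" using False unfolding j_def by simp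
        have "expansion B t n = nat \<lfloor>B (- 1 - int j) * greedy_rem B (- 1) t j\<rfloor>"
          using elim(1) False unfolding expansion_def greedy_digits_def n by simp
        moreover have "a n = nat (\<lceil>B (- 1 - int j) * qg_rem B j\<rceil> - 1)"
          using False unfolding a_def n Let_def by simp
        ultimately show ?thesis
          using elim(2)[THEN conjunct2] unfolding j_def[symmetric] by simp
      qed
    qed
  qed
  have "b = a" if "(expansion B \<longlongrightarrow> b) (at_left 1)" for b
  proof
    fix n
    have "\<forall>\<^sub>F t in at_left (1::real). b n = a n"
      using that[unfolded tendsto_fun_iff_eventually, rule_format, of n]
        lim[unfolded tendsto_fun_iff_eventually, rule_format, of n]
      by eventually_elim simp
    then show "b n = a n" by simp
  qed
  then have "(THE a. (expansion B \<longlongrightarrow> a) (at_left 1)) = a"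
    using lim by (metis (no_types, lifting) the_equality)
  then show ?thesis
    unfolding quasi_greedy_def a_def by (simp add: Let_def)
qed

lemma quasi_greedy_Suc_real:
  assumes B: "uniform_base B"
  shows "real (quasi_greedy B (Suc k)) = B (- 1 - int k) * qg_rem B k - qg_rem B (Suc k)"
proof -
  have "0 < B (- 1 - int k) * qg_rem B k"
    using uniform_base_pos[OF B] qg_rem_range by simp
  then have "\<lceil>B (- 1 - int k) * qg_rem B k\<rceil> - 1 \<ge> 0"
    by linarith
  then show ?thesis
    unfolding quasi_greedy_Suc[OF B] by simp
qed

lemma quasi_greedy_1_pos:
  assumes B: "uniform_base B"
  shows "quasi_greedy B 1 > 0"
proof -
  have "\<lceil>B (- 1)\<rceil> > 1" using uniform_base_gt_1[OF B, of "- 1"] by simp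
  then show ?thesis using quasi_greedy_Suc[OF B, of 0] by simp
qed

lemma quasi_greedy_infinitely_many_nonzero:
  assumes B: "uniform_base B"
  shows "\<exists>k\<ge>n. quasi_greedy B (Suc k) > 0"
proof (rule ccontr)
  assume "\<not> ?thesis"
  then have zero: "quasi_greedy B (Suc k) = 0" if "k \<ge> n" for k using that by auto
  obtain b where b: "b > 1" "\<And>n. b \<le> B n"
    using B unfolding uniform_base_def by blast
  have pos: "qg_rem B n > 0" using qg_rem_range by blast
  have grow: "b ^ k * qg_rem B n \<le> qg_rem B (n + k)" for k
  proof (induction k)
    case (Suc k)
    have "b ^ Suc k * qg_rem B n = b * (b ^ k * qg_rem B n)" by simp
    also have "\<dots> \<le> B (- 1 - int (n + k)) * qg_rem B (n + k)"
      using Suc b pos uniform_base_pos[OF B] by (intro mult_mono) (auto simp: less_imp_le)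
    also have "\<dots> = qg_rem B (n + Suc k)"
      using quasi_greedy_Suc_real[OF B, of "n + k"] zero[of "n + k"] by simp
    finally show ?case .
  qed simp
  obtain k where "1 / qg_rem B n < b ^ k" using real_arch_pow[OF b(1)] by blast
  then have "1 < b ^ k * qg_rem B n" using pos by (simp add: divide_less_eq)
  then show False
    using qg_rem_range[of B "n + k"] grow[of k] by linarith
qed


section \<open>Consecutive integers of an alternate base\<close>

text \<open>\<open>y\<close> is the successor of \<open>x\<close> among the \<open>B\<close>-integers.\<close>

definition consecutive :: "(int \<Rightarrow> real) \<Rightarrow> real \<Rightarrow> real \<Rightarrow> bool" where
  "consecutive B x y \<longleftrightarrow> x \<in> B_integers B \<and> y \<in> B_integers B \<and> x < y \<and>
     (\<forall>z\<in>B_integers B. \<not> (x < z \<and> z < y))"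

lemma greedy_rep_case_nat:
  assumes B: "uniform_base B"
  shows "greedy_rep B (B 0 * u) (case_nat c s) 0 \<longleftrightarrow>
    greedy_rep (shift_base 1 B) u s (real c / B 0)"
proof -
  have "case_nat c s \<circ> Suc = s" by auto
  then show ?thesis
    using greedy_rep_shift[OF B, of "B 0 * u" "case_nat c s" 0] uniform_base_pos[OF B, of 0] by simp
qed

lemma greedy_rep_case_nat_B_integer:
  assumes B: "uniform_base B"
  shows "greedy_rep B (B 0 * y + real c) (case_nat c s) 0 \<longleftrightarrow>
    greedy_rep (shift_base 1 B) (y + real c / B 0) s (real c / B 0)"
  using greedy_rep_case_nat[OF B, of "y + real c / B 0" c s] uniform_base_pos[OF B, of 0]
  by (simp add: distrib_left)

lemma greedy_rep_extend_0:
  assumes B: "uniform_base B" and y: "y \<in> B_integers (shift_base 1 B)"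
  shows "greedy_rep B (B 0 * y) (case_nat 0 (digits (shift_base 1 B) y)) 0"
  using greedy_rep_case_nat[OF B, of y 0] y B_integers_iff[OF uniform_base_shift[OF B]] by simp

text \<open>Every \<open>B\<close>-integer is \<open>B 0 * y + c\<close> with its last digit \<open>c\<close> and an integer \<open>y\<close> of the
  shifted base.\<close>

lemma B_integer_decompose:
  assumes B: "uniform_base B" and z: "z \<in> B_integers B"
  obtains y c where "y \<in> B_integers (shift_base 1 B)" "z = B 0 * y + real c"
    "greedy_rep B (B 0 * y + real c) (case_nat c (digits (shift_base 1 B) y)) 0"
    "digits B z = case_nat c (digits (shift_base 1 B) y)"
proof -
  let ?S = "shift_base 1 B"
  have B0: "B 0 > 0" using uniform_base_pos[OF B] .
  define c where "c = digits B z 0"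
  define s where "s = digits B z \<circ> Suc"
  define y where "y = z / B 0 - real c / B 0"
  have cs: "digits B z = case_nat c s"
    unfolding c_def s_def by (auto simp: fun_eq_iff split: nat.split)
  have z_eq: "z = B 0 * y + real c" unfolding y_def using B0 by (simp add: field_simps)
  have rep: "greedy_rep B z (case_nat c s) 0"
    using z B_integers_iff[OF B] cs by simp
  then have "greedy_rep ?S (y + real c / B 0) s (real c / B 0)"
    using greedy_rep_case_nat_B_integer[OF B] z_eq by simp
  then have "greedy_rep ?S y s 0"
    using greedy_rep_smaller_fraction[of ?S "y + real c / B 0" s "real c / B 0" 0] B0 by simp
  then have y: "y \<in> B_integers ?S" "s = digits ?S y"
    using B_integersI greedy_rep_digits uniform_base_shift[OF B] by blast+
  show ?thesis
    by (rule that[of y c]) (use y z_eq rep cs in simp_all)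
qed

lemma extension_less:
  assumes B: "uniform_base B"
    and y: "y \<in> B_integers (shift_base 1 B)" "y' \<in> B_integers (shift_base 1 B)" "y < y'"
    and rep: "greedy_rep B (B 0 * y + real c) (case_nat c (digits (shift_base 1 B) y)) 0"
  shows "B 0 * y + real c < B 0 * y'"
proof -
  let ?S = "shift_base 1 B"
  have S: "uniform_base ?S" using uniform_base_shift[OF B] .
  have reps: "greedy_rep ?S y (digits ?S y) 0" "greedy_rep ?S y' (digits ?S y') 0"
    using y B_integers_iff[OF S] by auto
  have "digits ?S y \<noteq> digits ?S y'"
    using greedy_rep_same_digits reps y(3) by fastforce
  then obtain n where n: "top_diff (digits ?S y) (digits ?S y') n"
    using greedy_rep_top_diff[OF S reps] by blast
  then have "digits ?S y n < digits ?S y' n"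
    using greedy_rep_less_top_diff[OF S reps] y(3) by blast
  moreover have "top_diff (case_nat c (digits ?S y)) (case_nat 0 (digits ?S y')) (Suc n)"
    using n unfolding top_diff_def by (auto split: nat.split)
  ultimately show ?thesis
    using greedy_rep_lex_less[OF B rep greedy_rep_extend_0[OF B y(2)]] by simp
qed

text \<open>Together with \<open>extension_less\<close>, this shows that appending \<open>c\<close> to the digits of \<open>y\<close> gives a
  greedy string exactly when \<open>B 0 * y + c\<close> does not reach \<open>B 0 * y'\<close>.\<close>

lemma extension_of_consecutive:
  assumes B: "uniform_base B" and cons: "consecutive (shift_base 1 B) y y'"
    and c: "real c < B 0 * (y' - y)"
  shows "greedy_rep B (B 0 * y + real c) (case_nat c (digits (shift_base 1 B) y)) 0"
proof -
  let ?S = "shift_base 1 B"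
  have S: "uniform_base ?S" using uniform_base_shift[OF B] .
  have B0: "B 0 > 0" using uniform_base_pos[OF B] .
  have y: "greedy_rep ?S y (digits ?S y) 0"
    using cons B_integers_iff[OF S] unfolding consecutive_def by blast
  define u where "u = y + real c / B 0"
  have u: "y \<le> u" "u < y'" unfolding u_def using B0 c by (simp_all add: field_simps)
  have "0 \<le> y" using greedy_rep_value_ge[OF S y, of 0] by simp
  then have "0 \<le> u" using u by simp
  then obtain f where f: "greedy_rep ?S u (digits ?S u) f"
    using expansion_greedy_rep[OF S] by blast
  have f0: "0 \<le> f" using f unfolding greedy_rep_def by blast
  have v: "greedy_rep ?S (u - f) (digits ?S u) 0"
    using greedy_rep_smaller_fraction[OF f, of 0] f0 by simp
  \<comment> \<open>The integer part of u lies in the interval from y to y', so it is y itself.\<close>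
  have "y \<le> u - f"
  proof (rule ccontr)
    assume less: "\<not> y \<le> u - f"
    then have "digits ?S u \<noteq> digits ?S y"
      using greedy_rep_same_digits[OF v] y by fastforce
    then obtain n where n: "top_diff (digits ?S u) (digits ?S y) n"
      using greedy_rep_top_diff[OF S v y] by blast
    then have "digits ?S u n < digits ?S y n"
      using greedy_rep_less_top_diff[OF S v y] less by simp
    then have "u < y"
      using greedy_rep_lex_less[OF S f y n] by blast
    then show False using u by simp
  qed
  moreover have "u - f < y'" using u f0 by simp
  moreover have "u - f \<in> B_integers ?S" using B_integersI[OF S v] .
  ultimately have "u - f = y"
    using cons unfolding consecutive_def by force
  then have "f = real c / B 0" "digits ?S u = digits ?S y"
    using greedy_rep_unique(1)[OF S v] y unfolding u_def by auto
  then show ?thesis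
    using f greedy_rep_case_nat_B_integer[OF B, of y c] unfolding u_def by simp
qed

lemma consecutive_within_block:
  assumes B: "uniform_base B" and cons: "consecutive (shift_base 1 B) y y'"
    and c: "real c + 1 < B 0 * (y' - y)"
  shows "consecutive B (B 0 * y + real c) (B 0 * y + real (Suc c))"
    (is "consecutive B ?x ?x'")
proof -
  let ?S = "shift_base 1 B"
  have B0: "B 0 > 0" using uniform_base_pos[OF B] .
  have y: "y \<in> B_integers ?S" "y' \<in> B_integers ?S" "\<And>z. z \<in> B_integers ?S \<Longrightarrow> \<not> (y < z \<and> z < y')"
    using cons unfolding consecutive_def by auto
  have mem: "?x \<in> B_integers B" "?x' \<in> B_integers B"
    using extension_of_consecutive[OF B cons, of c] extension_of_consecutive[OF B cons, of "Suc c"] c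
      B_integersI[OF B] by force+
  have "\<not> (?x < z \<and> z < ?x')" if z: "z \<in> B_integers B" for z
  proof -
    obtain u d where u: "u \<in> B_integers ?S" "z = B 0 * u + real d"
      "greedy_rep B (B 0 * u + real d) (case_nat d (digits ?S u)) 0"
      using B_integer_decompose[OF B z] by blast
    consider "u < y" | "u = y" | "y' \<le> u" using y(3)[OF u(1)] by force
    then show ?thesis
    proof cases
      case 1
      then show ?thesis using extension_less[OF B u(1) y(1) 1 u(3)] u(2) by simp
    next
      case 2
      then show ?thesis using u(2) by auto
    next
      case 3
      then have "B 0 * y' \<le> B 0 * u" using B0 by simp
      then show ?thesis using u(2) c by (simp add: algebra_simps)
    qed
  qed
  then show ?thesis using mem unfolding consecutive_def by simp
qed

lemma consecutive_end_of_block: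
  assumes B: "uniform_base B" and cons: "consecutive (shift_base 1 B) y y'"
    and c: "real c < B 0 * (y' - y)" "B 0 * (y' - y) \<le> real c + 1"
  shows "consecutive B (B 0 * y + real c) (B 0 * y')"
    (is "consecutive B ?x ?x'")
proof -
  let ?S = "shift_base 1 B"
  have B0: "B 0 > 0" using uniform_base_pos[OF B] .
  have y: "y \<in> B_integers ?S" "y' \<in> B_integers ?S" "\<And>z. z \<in> B_integers ?S \<Longrightarrow> \<not> (y < z \<and> z < y')"
    using cons unfolding consecutive_def by auto
  have mem: "?x \<in> B_integers B" "?x' \<in> B_integers B"
    using extension_of_consecutive[OF B cons c(1)] greedy_rep_extend_0[OF B y(2)] B_integersI[OF B]
    by blast+
  have "\<not> (?x < z \<and> z < ?x')" if z: "z \<in> B_integers B" for z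
  proof -
    obtain u d where u: "u \<in> B_integers ?S" "z = B 0 * u + real d"
      "greedy_rep B (B 0 * u + real d) (case_nat d (digits ?S u)) 0"
      using B_integer_decompose[OF B z] by blast
    consider "u < y" | "u = y" | "y' \<le> u" using y(3)[OF u(1)] by force
    then show ?thesis
    proof cases
      case 1
      then show ?thesis using extension_less[OF B u(1) y(1) 1 u(3)] u(2) by simp
    next
      case 2
      then have "d \<le> c \<or> Suc c \<le> d" by auto
      then show ?thesis using u(2) 2 c by (auto simp: algebra_simps)
    next
      case 3
      then have "B 0 * y' \<le> B 0 * u" using B0 by simp
      then show ?thesis using u(2) by simp
    qed
  qed
  then show ?thesis using mem c unfolding consecutive_def by (simp add: algebra_simps)
qed

text \<open>The distance between consecutive \<open>B\<close>-integers depends only on the greatest index \<open>n\<close> at which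
  they differ: it is the remainder after \<open>n\<close> steps of the quasi-greedy algorithm for the base
  shifted by \<open>n\<close>. In the induction step the two numbers are \<open>B 0 * u + c\<close> and \<open>B 0 * v\<close> with
  \<open>u\<close> and \<open>v\<close> consecutive in the shifted base, so the distance is \<open>B 0 * (v - u) - c\<close> with
  the greatest \<open>c\<close> that keeps it positive, which is one step of the quasi-greedy algorithm.\<close>

lemma consecutive_gap:
  assumes "uniform_base B" "consecutive B x y" "top_diff (digits B x) (digits B y) n"
  shows "y - x = qg_rem (shift_base (int n) B) n"
  using assms
proof (induction n arbitrary: B x y)
  case (0 B x y)
  note B = 0(1)
  let ?S = "shift_base 1 B"
  have S: "uniform_base ?S" using uniform_base_shift[OF B] .
  have B0: "B 0 > 0" using uniform_base_pos[OF B] .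
  have xy: "x \<in> B_integers B" "y \<in> B_integers B" "x < y"
    and none: "\<And>z. z \<in> B_integers B \<Longrightarrow> \<not> (x < z \<and> z < y)"
    using 0(2) unfolding consecutive_def by auto
  obtain u c where u: "u \<in> B_integers ?S" "x = B 0 * u + real c"
      "digits B x = case_nat c (digits ?S u)"
    using B_integer_decompose[OF B xy(1)] by blast
  obtain v d where v: "v \<in> B_integers ?S" "y = B 0 * v + real d"
      "greedy_rep B (B 0 * v + real d) (case_nat d (digits ?S v)) 0"
      "digits B y = case_nat d (digits ?S v)"
    using B_integer_decompose[OF B xy(2)] by blast
  \<comment> \<open>Only the last digits differ; a difference above 1 would leave a B-integer in between.\<close>
  have "digits ?S u = digits ?S v"
  proof
    fix m
    have "digits B x (Suc m) = digits B y (Suc m)" using 0(3) unfolding top_diff_def by blast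
    then show "digits ?S u m = digits ?S v m" unfolding u(3) v(4) by simp
  qed
  then have uv: "u = v"
    using greedy_rep_same_digits[of ?S u _ 0 v 0] u(1) v(1) B_integers_iff[OF S] by fastforce
  then have "c < d" using xy(3) u(2) v(2) by simp
  have "greedy_rep ?S (v + real d / B 0) (digits ?S v) (real d / B 0)"
    using v(3) greedy_rep_case_nat_B_integer[OF B] by blast
  then have "greedy_rep ?S (v + real (Suc c) / B 0) (digits ?S v) (real (Suc c) / B 0)"
    using greedy_rep_smaller_fraction[of ?S "v + real d / B 0" _ "real d / B 0" "real (Suc c) / B 0"]
      \<open>c < d\<close> B0 by (simp add: divide_right_mono)
  then have "B 0 * v + real (Suc c) \<in> B_integers B"
    using greedy_rep_case_nat_B_integer[OF B] B_integersI[OF B] by blast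
  then have "d = Suc c"
    using none[of "B 0 * v + real (Suc c)"] \<open>c < d\<close> unfolding u(2) v(2) uv by auto
  then show ?case unfolding u(2) v(2) uv by simp
next
  case (Suc n B x y)
  note B = Suc.prems(1)
  let ?S = "shift_base 1 B"
  have S: "uniform_base ?S" using uniform_base_shift[OF B] .
  have B0: "B 0 > 0" using uniform_base_pos[OF B] .
  have xy: "x \<in> B_integers B" "y \<in> B_integers B" "x < y"
    and none: "\<And>z. z \<in> B_integers B \<Longrightarrow> \<not> (x < z \<and> z < y)"
    using Suc.prems(2) unfolding consecutive_def by auto
  obtain u c where u: "u \<in> B_integers ?S" "x = B 0 * u + real c"
      "greedy_rep B (B 0 * u + real c) (case_nat c (digits ?S u)) 0"
      "digits B x = case_nat c (digits ?S u)"
    using B_integer_decompose[OF B xy(1)] by blast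
  obtain v d where v: "v \<in> B_integers ?S" "y = B 0 * v + real d"
      "digits B y = case_nat d (digits ?S v)"
    using B_integer_decompose[OF B xy(2)] by blast
  have reps: "greedy_rep ?S u (digits ?S u) 0" "greedy_rep ?S v (digits ?S v) 0"
    using u(1) v(1) B_integers_iff[OF S] by auto
  have diff: "top_diff (digits ?S u) (digits ?S v) n"
    unfolding top_diff_def
  proof (intro conjI allI impI)
    show "digits ?S u n \<noteq> digits ?S v n"
      using Suc.prems(3) unfolding top_diff_def u(4) v(3) by simp
    fix m assume "n < m"
    then have "digits B x (Suc m) = digits B y (Suc m)"
      using Suc.prems(3) unfolding top_diff_def by simp
    then show "digits ?S u m = digits ?S v m" unfolding u(4) v(3) by simp
  qed
  have "digits B x (Suc n) < digits B y (Suc n)"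
    using greedy_rep_less_top_diff[OF B _ _ Suc.prems(3)] xy B_integers_iff[OF B] by blast
  then have uv: "u < v"
    using greedy_rep_lex_less[OF S reps diff] unfolding u(4) v(3) by simp
  have Bv: "B 0 * w \<in> B_integers B" if "w \<in> B_integers ?S" for w
    using greedy_rep_extend_0[OF B that] B_integersI[OF B] by blast
  have cons: "consecutive ?S u v"
    unfolding consecutive_def
  proof (intro conjI ballI notI)
    fix w assume w: "w \<in> B_integers ?S" "u < w \<and> w < v"
    have "x < B 0 * w" using extension_less[OF B u(1) w(1) _ u(3)] w(2) u(2) by simp
    moreover have "B 0 * w < B 0 * v" using w(2) B0 by simp
    then have "B 0 * w < y" using v(2) by simp
    ultimately show False using none[OF Bv[OF w(1)]] by blast
  qed (use u v uv in auto)
  have "x < B 0 * v" using extension_less[OF B u(1) v(1) uv u(3)] u(2) by simp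
  then have y: "y = B 0 * v" using none[OF Bv[OF v(1)]] v(2) by simp
  have c_lt: "real c < B 0 * (v - u)" using xy(3) unfolding u(2) y by (simp add: algebra_simps)
  have c_ge: "B 0 * (v - u) \<le> real c + 1"
  proof (rule ccontr)
    assume *: "\<not> ?thesis"
    then have "B 0 * u + real (Suc c) \<in> B_integers B"
      using extension_of_consecutive[OF B cons, of "Suc c"] B_integersI[OF B] by simp
    then show False
      using none[of "B 0 * u + real (Suc c)"] * unfolding u(2) y by (simp add: algebra_simps)
  qed
  have gap: "v - u = qg_rem (shift_base (int (Suc n)) B) n"
    using Suc.IH[OF S cons diff] by (simp add: shift_base_shift_base add.commute)
  have "\<lceil>B 0 * (v - u)\<rceil> = int c + 1"
    using c_lt c_ge by linarith
  then show ?case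
    unfolding u(2) y using gap by (simp add: shift_base_def algebra_simps)
qed

text \<open>Hence \<open>D\<close> is the greatest digit that can be appended to \<open>y\<close>.\<close>

lemma gap_digit:
  assumes B: "uniform_base B" and cons: "consecutive (shift_base 1 B) y y'"
    and diff: "top_diff (digits (shift_base 1 B) y) (digits (shift_base 1 B) y') n"
  defines "D \<equiv> qg_digit B (n + 1) (n + 1)"
  shows "real D < B 0 * (y' - y)" "B 0 * (y' - y) \<le> real D + 1"
proof -
  let ?T = "shift_base (int (Suc n)) B"
  have "y' - y = qg_rem ?T n"
    using consecutive_gap[OF uniform_base_shift[OF B] cons diff]
    by (simp add: shift_base_shift_base add.commute)
  moreover have "real D = ?T (- 1 - int n) * qg_rem ?T n - qg_rem ?T (Suc n)"
    unfolding D_def qg_digit_def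
    using quasi_greedy_Suc_real[OF uniform_base_shift[OF B], of "int (Suc n)" n]
    by (simp only: Suc_eq_plus1)
  moreover have "?T (- 1 - int n) = B 0" by (simp add: shift_base_def)
  ultimately show "real D < B 0 * (y' - y)" "B 0 * (y' - y) \<le> real D + 1"
    using qg_rem_range[of ?T "Suc n"] by simp_all
qed


section \<open>Enumeration of the integers of an alternate base\<close>

lemma strict_mono_range_unique:
  fixes x y :: "nat \<Rightarrow> real"
  assumes "strict_mono x" "strict_mono y" "range x = range y"
  shows "x = y"
proof -
  have rank: "card {z \<in> range u. z < u k} = k" if "strict_mono u" for u :: "nat \<Rightarrow> real" and k
  proof -
    have "{z \<in> range u. z < u k} = u ` {..<k}"
      using strict_mono_less[OF that] by auto
    then show ?thesis
      using strict_mono_imp_inj_on[OF that] by (simp add: card_image inj_on_subset)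
  qed
  show ?thesis
  proof
    fix k
    obtain j where j: "x k = y j" using assms(3) by (metis rangeE rangeI)
    then show "x k = y k" using rank[OF assms(1), of k] rank[OF assms(2), of j] assms(3) by simp
  qed
qed

text \<open>The rank of an element is the number of smaller elements; the ranks form a downward closed
  infinite set of natural numbers.\<close>

lemma locally_finite_enumeration:
  fixes A :: "real set"
  assumes inf: "infinite A" and fin: "\<And>c. finite {z\<in>A. z < c}"
  shows "\<exists>x :: nat \<Rightarrow> real. strict_mono x \<and> range x = A"
proof -
  define rank where "rank z = card {u\<in>A. u < z}" for z
  have mono: "rank y < rank z" if "y \<in> A" "y < z" for y z
    unfolding rank_def using that fin[of z] by (intro psubset_card_mono) auto
  have inj: "inj_on rank A"
    by (rule linorder_inj_onI') (metis mono less_irrefl)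
  have down: "n \<in> rank ` A" if img: "Suc n \<in> rank ` A" for n
  proof -
    obtain z where z: "z \<in> A" "Suc n = rank z" using img by blast
    define U where "U = {u\<in>A. u < z}"
    have U: "finite U" "card U = Suc n" unfolding U_def using fin z by (auto simp: rank_def)
    then have "U \<noteq> {}" by auto
    then have M: "Max U \<in> U" using U by simp
    have "{u\<in>A. u < Max U} = U - {Max U}"
    proof (intro equalityI subsetI)
      fix u assume "u \<in> U - {Max U}"
      then show "u \<in> {u\<in>A. u < Max U}"
        using Max_ge[OF U(1), of u] unfolding U_def by auto
    qed (use M in \<open>auto simp: U_def\<close>)
    then have "rank (Max U) = n" unfolding rank_def using U M by simp
    then show ?thesis using M unfolding U_def by auto
  qed
  have down_le: "m \<in> rank ` A" if "n \<in> rank ` A" "m \<le> n" for m n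
    using that(2,1) by (induction rule: inc_induct) (use down in auto)
  have "infinite (rank ` A)" using inf inj finite_imageD by blast
  then have onto: "rank ` A = UNIV"
    using down_le unfolding infinite_nat_iff_unbounded_le by blast
  define x where "x = the_inv_into A rank"
  have x: "x n \<in> A" "rank (x n) = n" for n
    using the_inv_into_into[OF inj, of n A] f_the_inv_into_f[OF inj, of n] onto
    unfolding x_def by auto
  have "x m < x n" if "m < n" for m n
    using mono[of "x n" "x m"] x that by (metis less_asym less_irrefl linorder_less_linear)
  then have "strict_mono x" by (rule strict_monoI)
  moreover have "z \<in> range x" if "z \<in> A" for z
    using the_inv_into_f_f[OF inj that] unfolding x_def by (metis rangeI)
  ultimately show ?thesis using x(1) by blast
qed

lemma weight_B_integer:
  assumes B: "uniform_base B"
  shows "weight B n \<in> B_integers B"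
proof (rule B_integersI[OF B])
  define s where "s = (\<lambda>k. if k = n then 1 else 0 :: nat)"
  have low: "low_value B s k = (if k \<le> n then 0 else weight B n)" for k
  proof (induction k)
    case (Suc k)
    then show ?case
      by (cases k n rule: linorder_cases) (auto simp: low_value_Suc s_def)
  qed simp
  show "greedy_rep B (weight B n) s 0"
    unfolding greedy_rep_def
  proof (intro conjI allI)
    show "low_value B s k + 0 < weight B k" for k
      using weight_pos[OF B] strict_mono_less[OF strict_mono_weight[OF B], of n k] by (simp add: low)
    show "\<forall>\<^sub>F k in sequentially. low_value B s k + 0 = weight B n"
      using eventually_gt_at_top[of n] by eventually_elim (simp add: low)
  qed simp
qed

lemma finite_B_integers_below_weight:
  "uniform_base B \<Longrightarrow> finite {z \<in> B_integers B. z < weight B n}"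
proof (induction n arbitrary: B)
  case (0 B)
  have "z = 0" if z: "z \<in> B_integers B" "z < 1" for z
  proof -
    have rep: "greedy_rep B z (digits B z) 0" using z B_integers_iff[OF 0] by blast
    have "digits B z k = 0" for k
      using greedy_rep_digit_zero[OF 0 rep, of 0 k] z by simp
    then have "low_value B (digits B z) n = 0" for n
      by (simp add: low_value_def)
    then show "z = 0" using rep unfolding greedy_rep_def by simp
  qed
  then have "{z \<in> B_integers B. z < weight B 0} \<subseteq> {0}" by auto
  then show ?case by (rule finite_subset) simp
next
  case (Suc n B)
  note B = Suc.prems
  let ?S = "shift_base 1 B"
  have B0: "B 0 > 0" using uniform_base_pos[OF B] .
  have "{z \<in> B_integers B. z < weight B (Suc n)} \<subseteq>
    (\<lambda>(y, c). B 0 * y + real c) ` ({y \<in> B_integers ?S. y < weight ?S n} \<times> {..nat \<lceil>B 0\<rceil>})"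
  proof
    fix z assume "z \<in> {z \<in> B_integers B. z < weight B (Suc n)}"
    then have z: "z \<in> B_integers B" "z < weight B (Suc n)" by auto
    obtain y c where y: "y \<in> B_integers ?S" "z = B 0 * y + real c"
        "greedy_rep B (B 0 * y + real c) (case_nat c (digits ?S y)) 0"
      using B_integer_decompose[OF B z(1)] by blast
    have "B 0 * y < B 0 * weight ?S n"
      using z(2) y(2) weight_shift[of B n] by simp
    then have "y < weight ?S n" using B0 by simp
    moreover have "real c < B 0"
      using greedy_rep_digit_bound[OF B y(3), of 0] by simp
    then have "c \<le> nat \<lceil>B 0\<rceil>" by linarith
    ultimately show "z \<in> (\<lambda>(y, c). B 0 * y + real c) `
        ({y \<in> B_integers ?S. y < weight ?S n} \<times> {..nat \<lceil>B 0\<rceil>})"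
      using y(1,2) by (intro image_eqI[of _ _ "(y, c)"]) auto
  qed
  moreover have "finite {y \<in> B_integers ?S. y < weight ?S n}"
    using Suc.IH[OF uniform_base_shift[OF B]] .
  ultimately show ?case by (meson finite_SigmaI finite_atMost finite_imageI finite_subset)
qed

lemma B_integer_seq_enumerates:
  assumes B: "uniform_base B"
  shows "strict_mono (B_integer_seq B)" "range (B_integer_seq B) = B_integers B"
proof -
  have "infinite (range (weight B))"
    using strict_mono_imp_inj_on[OF strict_mono_weight[OF B]] by (rule range_inj_infinite)
  then have "infinite (B_integers B)"
    using weight_B_integer[OF B] by (meson finite_subset image_subsetI)
  moreover have "finite {z \<in> B_integers B. z < c}" for c
  proof -
    obtain n where "c < weight B n" using weight_unbounded[OF B] .
    then have "{z \<in> B_integers B. z < c} \<subseteq> {z \<in> B_integers B. z < weight B n}" by auto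
    then show ?thesis using finite_B_integers_below_weight[OF B] finite_subset by blast
  qed
  ultimately obtain x :: "nat \<Rightarrow> real" where x: "strict_mono x \<and> range x = B_integers B"
    using locally_finite_enumeration by blast
  have "strict_mono (B_integer_seq B) \<and> range (B_integer_seq B) = B_integers B"
    unfolding B_integer_seq_def
    by (rule theI[of _ x]) (use x strict_mono_range_unique[of _ x] in auto)
  then show "strict_mono (B_integer_seq B)" "range (B_integer_seq B) = B_integers B" by auto
qed

lemma consecutive_B_integer_seq:
  assumes B: "uniform_base B"
  shows "consecutive B (B_integer_seq B k) (B_integer_seq B (Suc k))"
  unfolding consecutive_def B_integer_seq_enumerates(2)[OF B, symmetric]
  using strict_mono_less[OF B_integer_seq_enumerates(1)[OF B]] by auto

lemma consecutive_determines_successor: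
  assumes "consecutive B x y" "consecutive B x y'"
  shows "y = y'"
  using assms unfolding consecutive_def by (meson linorder_less_linear)

lemma B_integer_seq_0:
  assumes B: "uniform_base B"
  shows "B_integer_seq B 0 = 0"
proof -
  have "greedy_rep B 0 (\<lambda>_. 0) 0"
    unfolding greedy_rep_def low_value_def using weight_pos[OF B] by simp
  then have "0 \<in> range (B_integer_seq B)"
    using B_integersI[OF B] B_integer_seq_enumerates(2)[OF B] by simp
  then obtain k where "B_integer_seq B k = 0" by auto
  then have "B_integer_seq B 0 \<le> 0"
    using strict_mono_less_eq[OF B_integer_seq_enumerates(1)[OF B], of 0 k] by simp
  moreover have "B_integer_seq B 0 \<in> B_integers B"
    using B_integer_seq_enumerates(2)[OF B] by auto
  then have "0 \<le> B_integer_seq B 0" unfolding B_integers_def by simp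
  ultimately show ?thesis by simp
qed

lemma w_seq_eqI:
  assumes "top_diff (digits B (B_integer_seq B k)) (digits B (B_integer_seq B (Suc k))) n"
  shows "w_seq B k = n"
  using assms unfolding w_seq_def top_diff_def digits_def
  by (intro Greatest_equality) (auto simp: not_less[symmetric])

lemma top_diff_w_seq:
  assumes B: "uniform_base B"
  shows "top_diff (digits B (B_integer_seq B k)) (digits B (B_integer_seq B (Suc k))) (w_seq B k)"
proof -
  let ?x = "B_integer_seq B k" and ?y = "B_integer_seq B (Suc k)"
  have reps: "greedy_rep B ?x (digits B ?x) 0" "greedy_rep B ?y (digits B ?y) 0" and less: "?x < ?y"
    using consecutive_B_integer_seq[OF B, of k] B_integers_iff[OF B] unfolding consecutive_def by auto
  have "digits B ?x \<noteq> digits B ?y"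
    using greedy_rep_same_digits[OF reps(1)] reps(2) less by fastforce
  then obtain n where "top_diff (digits B ?x) (digits B ?y) n"
    using greedy_rep_top_diff[OF B reps] by blast
  then show ?thesis using w_seq_eqI by metis
qed

section \<open>The coding of the shifted base determines that of the base\<close>

text \<open>The image of the letter \<open>n\<close> under the substitution over the infinite alphabet of all natural
  numbers that sends the coding of the shifted base to that of \<open>B\<close>. The substitutions
  \<^const>\<open>phi\<close> are its quotients on the finite alphabet.\<close>

definition letter_image :: "(int \<Rightarrow> real) \<Rightarrow> nat \<Rightarrow> nat list" where
  "letter_image B n = replicate (qg_digit B (n + 1) (n + 1)) 0 @ [n + 1]"

text \<open>The \<open>B\<close>-integers from \<open>B 0 * y\<close> up to, but excluding, \<open>B 0 * y'\<close>, for \<open>y\<close> and \<open>y'\<close>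
  consecutive in the shifted base, are \<open>B 0 * y + c\<close> with \<open>c \<le> D\<close>. All steps inside this
  block change only the digit with index 0, and in the last step the greatest index of a changed
  digit is one more than in the step from \<open>y\<close> to \<open>y'\<close>.\<close>

lemma w_seq_block:
  assumes B: "uniform_base B"
    and start: "B_integer_seq B k = B 0 * B_integer_seq (shift_base 1 B) j"
  defines "n \<equiv> w_seq (shift_base 1 B) j"
  defines "D \<equiv> qg_digit B (n + 1) (n + 1)"
  shows "B_integer_seq B (k + D + 1) = B 0 * B_integer_seq (shift_base 1 B) (Suc j)"
    "map (w_seq B) [k..<k + D + 1] = letter_image B n"
proof -
  let ?S = "shift_base 1 B"
  define y where "y = B_integer_seq ?S j"
  define y' where "y' = B_integer_seq ?S (Suc j)"
  have S: "uniform_base ?S" using uniform_base_shift[OF B] .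
  have cons: "consecutive ?S y y'"
    unfolding y_def y'_def by (rule consecutive_B_integer_seq[OF S])
  have diff: "top_diff (digits ?S y) (digits ?S y') n"
    unfolding y_def y'_def n_def by (rule top_diff_w_seq[OF S])
  have D: "real D < B 0 * (y' - y)" "B 0 * (y' - y) \<le> real D + 1"
    unfolding D_def using gap_digit[OF B cons diff] by auto
  have seq: "B_integer_seq B (k + c) = B 0 * y + real c" if "c \<le> D" for c
    using that
  proof (induction c)
    case 0
    then show ?case using start y_def by simp
  next
    case (Suc c)
    then have "consecutive B (B_integer_seq B (k + c)) (B 0 * y + real (Suc c))"
      using consecutive_within_block[OF B cons, of c] D(1) by simp
    then show ?case
      using consecutive_determines_successor consecutive_B_integer_seq[OF B, of "k + c"] by simp
  qed
  have "consecutive B (B_integer_seq B (k + D)) (B 0 * y')"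
    using consecutive_end_of_block[OF B cons D] seq[of D] by simp
  then show last: "B_integer_seq B (k + D + 1) = B 0 * B_integer_seq ?S (Suc j)"
    using consecutive_determines_successor consecutive_B_integer_seq[OF B, of "k + D"]
    unfolding y'_def by simp
  have digs: "digits B (B_integer_seq B (k + c)) = case_nat c (digits ?S y)" if "c \<le> D" for c
  proof -
    have "real c < B 0 * (y' - y)" using D(1) that by (meson le_less_trans of_nat_le_iff)
    then show ?thesis
      using greedy_rep_digits[OF B extension_of_consecutive[OF B cons]] seq[OF that] by simp
  qed
  have "y' \<in> B_integers ?S" using cons unfolding consecutive_def by blast
  then have digs_last: "digits B (B_integer_seq B (k + D + 1)) = case_nat 0 (digits ?S y')"
    using greedy_rep_digits[OF B greedy_rep_extend_0[OF B]] last unfolding y'_def by simp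
  have inner: "w_seq B (k + c) = 0" if "c < D" for c
  proof (rule w_seq_eqI)
    show "top_diff (digits B (B_integer_seq B (k + c))) (digits B (B_integer_seq B (Suc (k + c)))) 0"
      using digs[of c] digs[of "Suc c"] that unfolding top_diff_def by (auto split: nat.split)
  qed
  have "w_seq B (k + D) = n + 1"
  proof (rule w_seq_eqI)
    show "top_diff (digits B (B_integer_seq B (k + D))) (digits B (B_integer_seq B (Suc (k + D)))) (n + 1)"
      using digs[of D] digs_last diff unfolding top_diff_def by (auto split: nat.split)
  qed
  moreover have "map (w_seq B) [k..<k + D] = replicate D 0"
    by (rule nth_equalityI) (use inner in auto)
  ultimately show "map (w_seq B) [k..<k + D + 1] = letter_image B n"
    unfolding letter_image_def D_def[symmetric] by simp
qed

lemma w_seq_prefix_image: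
  assumes B: "uniform_base B"
  shows "\<exists>K'\<ge>K. map (w_seq B) [0..<K'] =
    concat (map (letter_image B) (map (w_seq (shift_base 1 B)) [0..<K]))"
proof -
  let ?S = "shift_base 1 B"
  have "\<exists>K'\<ge>K. B_integer_seq B K' = B 0 * B_integer_seq ?S K \<and>
    map (w_seq B) [0..<K'] = concat (map (letter_image B) (map (w_seq ?S) [0..<K]))"
  proof (induction K)
    case 0
    show ?case
      by (rule exI[of _ 0]) (simp add: B_integer_seq_0 B uniform_base_shift)
  next
    case (Suc K)
    then obtain K' where K': "K' \<ge> K" "B_integer_seq B K' = B 0 * B_integer_seq ?S K"
        "map (w_seq B) [0..<K'] = concat (map (letter_image B) (map (w_seq ?S) [0..<K]))"
      by blast
    define D where "D = qg_digit B (w_seq ?S K + 1) (w_seq ?S K + 1)"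
    have "[0..<K' + D + 1] = [0..<K'] @ [K'..<K' + D + 1]"
      using upt_add_eq_append[of 0 K' "D + 1"] by (simp add: add.assoc)
    then have "map (w_seq B) [0..<K' + D + 1] =
        concat (map (letter_image B) (map (w_seq ?S) [0..<Suc K]))"
      using w_seq_block(2)[OF B K'(2)] K'(3) unfolding D_def by simp
    moreover have "B_integer_seq B (K' + D + 1) = B 0 * B_integer_seq ?S (Suc K)"
      unfolding D_def by (rule w_seq_block(1)[OF B K'(2)])
    moreover have "Suc K \<le> K' + D + 1" using K'(1) by simp
    ultimately show ?case by blast
  qed
  then show ?thesis by blast
qed


section \<open>Compositions of substitutions\<close>

text \<open>The map from the natural numbers to the finite alphabet that turns the sequence of greatest
  differing indices into the letters of \<^const>\<open>v_word\<close>.\<close>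

definition project :: "nat \<Rightarrow> nat \<Rightarrow> nat \<Rightarrow> nat \<Rightarrow> nat" where
  "project p l m n = (if n < l * p then n else l * p + (n - l * p) mod (m * p))"

text \<open>Application of the first \<open>t\<close> factors of
  \<open>phi (p - 1)\<close>, \<open>phi (p - 2)\<close>, \<open>\<dots>\<close>, \<open>phi 0\<close>, \<open>phi (p - 1)\<close>, \<open>\<dots>\<close> in this cyclic
  order, so that \<open>p\<close> steps make up \<^const>\<open>phi_comp\<close>.\<close>

primrec phi_iter :: "nat \<Rightarrow> (int \<Rightarrow> real) \<Rightarrow> nat \<Rightarrow> nat \<Rightarrow> nat \<Rightarrow> nat list \<Rightarrow> nat list" where
  "phi_iter p B l m 0 u = u"
| "phi_iter p B l m (Suc t) u = phi p B l m (p - 1 - t mod p) (phi_iter p B l m t u)"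

lemma phi_append: "phi p B l m i (u @ v) = phi p B l m i u @ phi p B l m i v"
  by (simp add: phi_def extend_word_def)

lemma phi_Nil [simp]: "phi p B l m i [] = []"
  by (simp add: phi_def extend_word_def)

lemma phi_iter_append: "phi_iter p B l m t (u @ v) = phi_iter p B l m t u @ phi_iter p B l m t v"
  by (induction t) (simp_all add: phi_append)

lemma phi_iter_Nil [simp]: "phi_iter p B l m t [] = []"
  by (induction t) simp_all

lemma phi_iter_nonempty: "u \<noteq> [] \<Longrightarrow> phi_iter p B l m t u \<noteq> []"
proof (induction t)
  case (Suc t)
  then show ?case
    by (cases "phi_iter p B l m t u") (auto simp: phi_def extend_word_def phi_letter_def)
qed simp

lemma phi_comp_eq_phi_iter: "phi_comp p B l m = phi_iter p B l m p"
proof -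
  have "foldr (\<circ>) (map (phi p B l m) [i..<p]) id = phi_iter p B l m (p - i)" if "i \<le> p" for i
    using that
  proof (induction rule: inc_induct)
    case base
    show ?case by auto
  next
    case (step i)
    have "p - i = Suc (p - Suc i)" "p - 1 - (p - Suc i) mod p = i" using step.hyps by auto
    then show ?case
      using step by (auto simp: upt_conv_Cons)
  qed
  then show ?thesis unfolding phi_comp_def by simp
qed

lemma phi_iter_add_multiple:
  "phi_iter p B l m (t + n * p) u = phi_iter p B l m t (phi_iter p B l m (n * p) u)"
  by (induction t) simp_all

lemma phi_comp_funpow: "(phi_comp p B l m ^^ n) u = phi_iter p B l m (n * p) u"
  by (induction n) (simp_all add: phi_comp_eq_phi_iter phi_iter_add_multiple)

lemma morphism_eq_concat:
  assumes "\<psi> [] = []" "\<And>u v. \<psi> (u @ v) = \<psi> u @ \<psi> v"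
  shows "\<psi> u = concat (map (\<lambda>a. \<psi> [a]) u)"
proof (induction u)
  case (Cons a u)
  then show ?case using assms(2)[of "[a]" u] by simp
qed (simp add: assms)

lemma incidence_matrix_pow_pos:
  assumes "\<psi> [] = []" "\<And>u v. \<psi> (u @ v) = \<psi> u @ \<psi> v"
    and letters: "\<And>b. b < L \<Longrightarrow> set (\<psi> [b]) \<subseteq> {..<L}"
    and "a < L" "b < L" "a \<in> set ((\<psi> ^^ n) [b])"
  shows "(incidence_matrix L \<psi> ^\<^sub>m n) $$ (a, b) > 0"
  using assms(4-6)
proof (induction n arbitrary: a b)
  case 0
  then show ?case by (simp add: incidence_matrix_def)
next
  case (Suc n)
  let ?M = "incidence_matrix L \<psi>"
  have carrier: "?M \<in> carrier_mat L L" by (simp add: incidence_matrix_def)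
  have "(\<psi> ^^ n) [] = []" by (induction n) (auto simp: assms)
  moreover have "(\<psi> ^^ n) (u @ v) = (\<psi> ^^ n) u @ (\<psi> ^^ n) v" for u v
    by (induction n) (auto simp: assms)
  ultimately have "(\<psi> ^^ Suc n) [b] = concat (map (\<lambda>c. (\<psi> ^^ n) [c]) (\<psi> [b]))"
    by (simp only: funpow_Suc_right comp_def morphism_eq_concat[of "\<psi> ^^ n" "\<psi> [b]"])
  then obtain c where c: "c \<in> set (\<psi> [b])" "a \<in> set ((\<psi> ^^ n) [c])"
    using Suc.prems(3) by auto
  then have "c < L" using letters[OF Suc.prems(2)] by auto
  have "0 < (?M ^\<^sub>m n) $$ (a, c) * ?M $$ (c, b)"
  proof (rule mult_pos_pos)
    show "0 < (?M ^\<^sub>m n) $$ (a, c)" using Suc.IH[OF Suc.prems(1) \<open>c < L\<close> c(2)] .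
    show "0 < ?M $$ (c, b)"
      using \<open>c < L\<close> Suc.prems(2) c(1) by (simp add: incidence_matrix_def count_list_0_iff flip: neq0_conv)
  qed
  also have "\<dots> \<le> (\<Sum>k<L. (?M ^\<^sub>m n) $$ (a, k) * ?M $$ (k, b))"
    using \<open>c < L\<close> by (intro member_le_sum) auto
  also have "\<dots> = (?M ^\<^sub>m Suc n) $$ (a, b)"
    using carrier pow_carrier_mat[OF carrier, of n] Suc.prems
    by (simp add: scalar_prod_def lessThan_atLeast0)
  finally show ?case .
qed

lemma flat_smap_prefix:
  assumes "\<And>a. f a \<noteq> []"
  shows "flat (smap f v) = concat (map f (stake K v)) @- flat (smap f (sdrop K v))"
proof (induction K arbitrary: v)
  case (Suc K)
  have "flat (smap f v) = f (shd v) @- flat (smap f (stl v))"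
    using flat_unfold[of "smap f v"] assms by simp
  then show ?case using Suc[of "stl v"] by simp
qed simp

section \<open>Periodic quasi-greedy expansions\<close>

text \<open>An alternate base whose quasi-greedy expansions have preperiod \<open>l * p\<close> and period
  \<open>m * p\<close>.\<close>

locale periodic_expansions =
  fixes p l m :: nat and B :: "int \<Rightarrow> real"
  assumes alternate: "alternate_base p B"
    and m_pos: "m \<ge> 1"
    and periodic: "\<And>i j. i < p \<Longrightarrow> j > l * p \<Longrightarrow> qg_digit B i (j + m * p) = qg_digit B i j"
begin

abbreviation proj :: "nat \<Rightarrow> nat" where "proj \<equiv> project p l m"

abbreviation L :: nat where "L \<equiv> l * p + m * p"

lemma p_pos: "p > 0"
  using alternate unfolding alternate_base_def by simp

lemma mp_pos: "m * p > 0"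
  using p_pos m_pos by simp

lemma uniform: "uniform_base B"
  using alternate_base_uniform[OF alternate] .

lemma qg_digit_cong:
  assumes "n mod p = n' mod p"
  shows "qg_digit B n = qg_digit B n'"
proof -
  have "shift_base (int n) B = shift_base (int (n mod p)) B" for n
  proof
    fix k
    have "int n = int (n mod p) + int (n div p) * int p"
      by (metis add.commute div_mult_mod_eq of_nat_add of_nat_mult)
    then show "shift_base (int n) B k = shift_base (int (n mod p)) B k"
      using alternate_base_periodic[OF alternate, of "k + int (n mod p)" "int (n div p)"]
      by (simp add: shift_base_def add.assoc)
  qed
  then show ?thesis unfolding qg_digit_def using assms by metis
qed

lemma qg_digit_periodic:
  assumes "j > l * p"
  shows "qg_digit B i (j + k * (m * p)) = qg_digit B i j"
proof (induction k)
  case (Suc k)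
  have "qg_digit B i (j + Suc k * (m * p)) = qg_digit B (i mod p) ((j + k * (m * p)) + m * p)"
    by (simp add: qg_digit_cong[of i "i mod p"] add_ac)
  also have "\<dots> = qg_digit B (i mod p) (j + k * (m * p))"
    using assms p_pos by (intro periodic) auto
  also have "\<dots> = qg_digit B i (j + k * (m * p))"
    by (simp add: qg_digit_cong[of i "i mod p"])
  finally show ?case using Suc by simp
qed simp

lemma proj_decompose: "\<exists>k. n = proj n + k * (m * p) \<and> (k = 0 \<or> l * p \<le> proj n)"
proof (cases "n < l * p")
  case False
  have "n - l * p = (n - l * p) mod (m * p) + ((n - l * p) div (m * p)) * (m * p)"
    by (rule mod_div_mult_eq[symmetric])
  then have "n = proj n + ((n - l * p) div (m * p)) * (m * p)"
    using False by (simp add: project_def del: mod_mult_div_eq div_mult_mod_eq mod_div_mult_eq mult_div_mod_eq)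
  then show ?thesis using False by (metis le_add1 project_def)
qed (auto simp: project_def)

lemma proj_mod: "proj n mod p = n mod p"
proof -
  obtain k where "n = proj n + k * (m * p)" using proj_decompose by blast
  then show ?thesis by (metis mod_mult_self1 mult.assoc)
qed

lemma qg_digit_proj: "qg_digit B i (Suc (proj n)) = qg_digit B i (Suc n)"
proof -
  obtain k where k: "n = proj n + k * (m * p)" "k = 0 \<or> l * p \<le> proj n"
    using proj_decompose by blast
  show ?thesis
  proof (cases "k = 0")
    case False
    then have "qg_digit B i (Suc (proj n) + k * (m * p)) = qg_digit B i (Suc (proj n))"
      using k(2) by (intro qg_digit_periodic) simp
    then show ?thesis using k(1) by simp
  qed (use k in simp)
qed

lemma proj_less: "proj n < L"
  using mp_pos unfolding project_def by auto

lemma proj_id: "n < L \<Longrightarrow> proj n = n"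
  unfolding project_def by auto

lemma proj_0 [simp]: "proj 0 = 0"
  unfolding project_def by auto

lemma proj_Suc: "proj (Suc n) = (if proj n < L - 1 then Suc (proj n) else l * p)"
proof (cases "n < l * p")
  case True
  then show ?thesis using mp_pos unfolding project_def by (cases "Suc n = l * p") auto
next
  case False
  then have "Suc n - l * p = Suc (n - l * p)" by simp
  then show ?thesis
    using False mod_less_divisor[OF mp_pos, of "n - l * p"] unfolding project_def
    by (auto simp: mod_Suc)
qed

lemma qg_digit_shift: "qg_digit (shift_base (int i) B) n = qg_digit B (i + n)"
  unfolding qg_digit_def by (simp add: shift_base_shift_base add.commute)

text \<open>The substitution over the infinite alphabet and its quotient commute with the projection,
  because both the digit \<open>n + 1\<close> and the index of the base take the same values for all letters
  with the same projection.\<close>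

lemma phi_letter_proj:
  "phi_letter p B l m i (proj n) = map proj (letter_image (shift_base (int i) B) n)"
proof -
  have "qg_digit B (i + (n + 1)) = qg_digit B (i + proj n + 1)"
    by (rule qg_digit_cong) (metis add.assoc add.commute mod_add_cong proj_mod)
  then have digit: "qg_digit B (i + (n + 1)) (n + 1) = qg_digit B (i + proj n + 1) (proj n + 1)"
    using qg_digit_proj by simp
  have image: "map proj (letter_image (shift_base (int i) B) n) =
      replicate (qg_digit B (i + proj n + 1) (proj n + 1)) 0 @ [proj (n + 1)]"
    unfolding letter_image_def qg_digit_shift digit by simp
  show ?thesis
  proof (cases "proj n < L - 1")
    case True
    then show ?thesis unfolding image phi_letter_def using proj_Suc[of n] by simp
  next
    case False
    then have "proj n + 1 = L" using proj_less[of n] by simp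
    moreover have "qg_digit B (i + L) = qg_digit B i"
      by (rule qg_digit_cong) (metis add_mult_distrib mod_mult_self1)
    ultimately have "qg_digit B (i + proj n + 1) (proj n + 1) = qg_digit B i L"
      by (metis add.assoc)
    then show ?thesis
      unfolding image phi_letter_def using proj_Suc[of n] False by simp
  qed
qed

lemma phi_proj:
  "phi p B l m i (map proj u) = map proj (concat (map (letter_image (shift_base (int i) B)) u))"
  by (induction u) (simp_all add: phi_def extend_word_def phi_letter_proj)

lemma phi_letters:
  assumes "set u \<subseteq> {..<L}"
  shows "set (phi p B l m i u) \<subseteq> {..<L}"
proof -
  have "u = map proj u" using assms proj_id by (induction u) auto
  then have "phi p B l m i u = map proj (concat (map (letter_image (shift_base (int i) B)) u))"
    using phi_proj by metis
  then show ?thesis using proj_less by auto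
qed

lemma phi_iter_letters:
  "set u \<subseteq> {..<L} \<Longrightarrow> set (phi_iter p B l m t u) \<subseteq> {..<L}"
  by (induction t) (simp_all add: phi_letters)

lemma substitution_phi_comp: "substitution L (phi_comp p B l m)"
  unfolding substitution_def phi_comp_eq_phi_iter
  using phi_iter_letters by (auto simp: phi_iter_append lists_eq_set subset_iff)

lemma set_phi: "set (phi p B l m i u) = (\<Union>a\<in>set u. set (phi_letter p B l m i a))"
  by (simp add: phi_def extend_word_def)

lemma proj_Suc_in_phi:
  assumes "proj n \<in> set u"
  shows "proj (Suc n) \<in> set (phi p B l m i u)"
proof -
  have "proj (Suc n) \<in> set (phi_letter p B l m i (proj n))"
    unfolding phi_letter_proj letter_image_def by simp
  then show ?thesis using assms set_phi by blast
qed

lemma zero_in_phi: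
  assumes "proj n \<in> set u" "qg_digit B (i + Suc n) (Suc n) > 0"
  shows "0 \<in> set (phi p B l m i u)"
proof -
  have "0 \<in> set (phi_letter p B l m i (proj n))"
    unfolding phi_letter_proj letter_image_def using assms(2) by (simp add: qg_digit_shift)
  then show ?thesis using assms set_phi by blast
qed

lemma zero_persists:
  assumes "0 \<in> set (phi_iter p B l m t u)"
  shows "0 \<in> set (phi_iter p B l m (t + s) u)"
proof (induction s)
  case (Suc s)
  have "qg_digit B (i + Suc 0) (Suc 0) > 0" for i
    unfolding qg_digit_def using quasi_greedy_1_pos[OF uniform_base_shift[OF uniform]] by simp
  then show ?case using zero_in_phi[of 0] Suc by simp
qed (use assms in simp)

lemma proj_in_phi_iter:
  assumes "proj n \<in> set (phi_iter p B l m t u)"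
  shows "proj (n + s) \<in> set (phi_iter p B l m (t + s) u)"
  by (induction s) (use assms proj_Suc_in_phi in auto)

text \<open>Along the letters \<open>proj (b + t)\<close> that descend from \<open>b\<close>, the number of zeros produced at step
  \<open>t\<close> is the digit \<open>b + t + 1\<close> of one and the same quasi-greedy expansion, since the indices of
  the successive substitutions decrease as the letters increase. This expansion has infinitely
  many nonzero digits.\<close>

lemma zero_reached:
  assumes "b < L"
  shows "\<exists>t. 0 \<in> set (phi_iter p B l m t [b])"
proof -
  obtain k where k: "k \<ge> b" "qg_digit B b (Suc k) > 0"
    using quasi_greedy_infinitely_many_nonzero[OF uniform_base_shift[OF uniform]]
    unfolding qg_digit_def by blast
  define t where "t = k - b"
  have kt: "k = b + t" using k(1) unfolding t_def by simp
  have "proj k \<in> set (phi_iter p B l m t [b])"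
    using proj_in_phi_iter[of b 0 "[b]" t] proj_id[OF assms] unfolding kt by simp
  moreover have "p - 1 - r + Suc (b + (q * p + r)) = b + (q + 1) * p" if "r < p" for q r
    using that by (simp add: algebra_simps)
  from this[of "t mod p" "t div p"] have "p - 1 - t mod p + Suc k = b + (t div p + 1) * p"
    using p_pos unfolding kt by (simp only: div_mult_mod_eq mod_less_divisor)
  then have "qg_digit B (p - 1 - t mod p + Suc k) = qg_digit B b"
    by (intro qg_digit_cong) (metis mod_mult_self1)
  then have "qg_digit B (p - 1 - t mod p + Suc k) (Suc k) > 0" using k(2) by simp
  ultimately have "0 \<in> set (phi_iter p B l m (Suc t) [b])"
    using zero_in_phi by simp
  then show ?thesis by blast
qed

text \<open>From any letter the letter 0 is reached, it persists since every quasi-greedy expansion has a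
  positive first digit, and from 0 each letter \<open>a\<close> is reached after \<open>a\<close> further steps.\<close>

lemma primitive_phi_comp: "primitive_substitution L (phi_comp p B l m)"
proof -
  obtain \<tau> where \<tau>: "0 \<in> set (phi_iter p B l m (\<tau> b) [b])" if "b < L" for b
    using zero_reached by metis
  define n where "n = (\<Sum>b<L. \<tau> b) + L"
  have "n \<ge> 1" unfolding n_def using mp_pos by linarith
  moreover have "(incidence_matrix L (phi_comp p B l m) ^\<^sub>m n) $$ (a, b) > 0"
    if ab: "a < L" "b < L" for a b
  proof (rule incidence_matrix_pow_pos)
    have "\<tau> b \<le> (\<Sum>b<L. \<tau> b)" using ab by (intro member_le_sum) auto
    moreover have "n \<le> n * p" using p_pos by simp
    ultimately have le: "\<tau> b + a \<le> n * p" unfolding n_def using ab by linarith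
    define s where "s = n * p - (\<tau> b + a)"
    have "proj 0 \<in> set (phi_iter p B l m (\<tau> b + s) [b])"
      using zero_persists[OF \<tau>[OF ab(2)]] by simp
    then have "proj (0 + a) \<in> set (phi_iter p B l m (\<tau> b + s + a) [b])"
      by (rule proj_in_phi_iter)
    moreover have "\<tau> b + s + a = n * p" unfolding s_def using le by simp
    ultimately show "a \<in> set ((phi_comp p B l m ^^ n) [b])"
      using proj_id[OF ab(1)] by (simp add: phi_comp_funpow)
  qed (use ab phi_iter_letters in \<open>auto simp: phi_comp_eq_phi_iter phi_iter_append\<close>)
  ultimately show ?thesis
    unfolding primitive_substitution_def using substitution_phi_comp by blast
qed

text \<open>After \<open>t\<close> steps a prefix of the word of \<open>B\<close>, which is also the word of the base shifted by
  \<open>p\<close>, has become a prefix of the word of the base shifted by \<open>p - t\<close>.\<close>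

lemma phi_iter_prefix:
  assumes "t \<le> p"
  shows "\<exists>K'\<ge>K. phi_iter p B l m t (map proj (map (w_seq B) [0..<K])) =
    map proj (map (w_seq (shift_base (int (p - t)) B)) [0..<K'])"
  using assms
proof (induction t)
  case 0
  have "shift_base (int p) B = B"
    using alternate unfolding alternate_base_def shift_base_def by auto
  then show ?case by auto
next
  case (Suc t)
  then obtain K1 where K1: "K1 \<ge> K" "phi_iter p B l m t (map proj (map (w_seq B) [0..<K])) =
      map proj (map (w_seq (shift_base (int (p - t)) B)) [0..<K1])"
    by auto
  let ?C = "shift_base (int (p - Suc t)) B"
  have "p - t = Suc (p - Suc t)" "p - 1 - t mod p = p - Suc t" using Suc.prems by auto
  then have idx: "shift_base 1 ?C = shift_base (int (p - t)) B" "p - 1 - t mod p = p - Suc t"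
    by (simp_all add: shift_base_shift_base)
  obtain K' where K': "K' \<ge> K1" "map (w_seq ?C) [0..<K'] =
      concat (map (letter_image ?C) (map (w_seq (shift_base 1 ?C)) [0..<K1]))"
    using w_seq_prefix_image[OF uniform_base_shift[OF uniform]] by blast
  have "phi_iter p B l m (Suc t) (map proj (map (w_seq B) [0..<K])) =
      map proj (map (w_seq ?C) [0..<K'])"
    unfolding phi_iter.simps K1(2) K'(2) idx phi_proj ..
  then show ?case using K1(1) K'(1) order.trans by blast
qed

lemma stake_v_word: "stake K (v_word p B l m) = map proj (map (w_seq B) [0..<K])"
  by (rule nth_equalityI) (simp_all add: v_word_def project_def)

lemma v_word_fixed: "apply_inf (phi_comp p B l m) (v_word p B l m) = v_word p B l m"
proof -
  let ?\<phi> = "phi_comp p B l m" and ?v = "v_word p B l m"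
  have "apply_inf ?\<phi> ?v !! k = ?v !! k" for k
  proof -
    \<comment> \<open>The image of a prefix of the word is a prefix that is at least as long.\<close>
    obtain K' where K': "K' \<ge> Suc k" "?\<phi> (stake (Suc k) ?v) = stake K' ?v"
      using phi_iter_prefix[of p "Suc k"] unfolding stake_v_word phi_comp_eq_phi_iter
      by (auto simp: shift_base_def)
    have "?\<phi> (stake (Suc k) ?v) = concat (map (\<lambda>a. ?\<phi> [a]) (stake (Suc k) ?v))"
      by (rule morphism_eq_concat) (simp_all add: phi_comp_eq_phi_iter phi_iter_append)
    moreover have "?\<phi> [a] \<noteq> []" for a
      by (simp add: phi_comp_eq_phi_iter phi_iter_nonempty)
    ultimately obtain rest where "apply_inf ?\<phi> ?v = stake K' ?v @- rest"
      unfolding apply_inf_def using flat_smap_prefix[of "\<lambda>a. ?\<phi> [a]" ?v "Suc k"] K'(2) by metis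
    then show ?thesis using K'(1) by (simp add: shift_snth_less stake_nth)
  qed
  then have "snth (apply_inf ?\<phi> ?v) = snth ?v" by (rule ext)
  then show ?thesis by (metis stream_smap_nats)
qed

end

theorem theorem22:
  fixes p l m :: nat and B :: "int \<Rightarrow> real"
  assumes "alternate_base p B"
    and "parry p B"
    and "m \<ge> 1"
    and "\<And>i j. i < p \<Longrightarrow> j > l * p \<Longrightarrow> qg_digit B i (j + m * p) = qg_digit B i j"
  shows "primitive_substitution (l * p + m * p) (phi_comp p B l m) \<and>
         apply_inf (phi_comp p B l m) (v_word p B l m) = v_word p B l m"
proof -
  interpret periodic_expansions p l m B
    using assms by unfold_locales auto
  show ?thesis
    using primitive_phi_comp v_word_fixed by blast
qed

end
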